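(* There is an absolute constant $C>0$ such that the following holds. Let $L > 0$, and let $E \subset \mathbb{R}^2$ be a compact subset of the open unit ball $B(0,1)$ with $\mathcal{S}^1(E) \le L$. Let $N \ge 1$ be an integer, and suppose there are scales $$0 < r_{N,-} \le r_{N,+} \le r_{N-1,-} \le r_{N-1,+} \le \dots \le r_{1,-} \le r_{1,+} \le 1$$ such that: (1) for all $1 \le n \le N$, $\mathcal{S}^1_{r_{n,-},r_{n,+}}(E) \le L$; (2) for all $1 \le n < N$, $r_{n+1,+} \le \frac12 r_{n,-}$; (3) for all $1 \le n < N$, $R_E\big(r_{n+1,+}, r_{n,-}, 1/r_{n,-}\big) \le N^{-1/100}$. Then $\mathrm{Fav}(E) \le C N^{-1/100} L$.
   Context: For $E \subset \mathbb{R}^2$ and $0 \le r_- < r_+$ (or $r_-\le r_+$), the restricted spherical content is $\mathcal{S}^1_{r_-,r_+}(E) = \inf \sum_{B \in \mathcal{B}} \mathrm{diam}(B)$, the infimum over all at most countable collections $\mathcal{B}$ of open balls of radii in $[r_-,r_+]$ covering $E$. The one-dimensional spherical measure is $\mathcal{S}^1(E) = \lim_{r_+\to 0}\mathcal{S}^1_{0,r_+}(E)$. Let $\sigma$ be arclength measure on $S^1$ normalised to total mass $1$, and $m$ Lebesgue measure on $\mathbb{R}$. For $(c,\omega) \in \mathbb{R}\times S^1$ let $l_{c,\omega} = \{x \in \mathbb{R}^2 : x\cdot\omega = c\}$. The Favard length of $E \subset \mathbb{R}^2$ is $\mathrm{Fav}(E) = (m\times\sigma)(\{(c,\omega) \in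 \mathbb{R}\times S^1 : l_{c,\omega}\cap E \ne \emptyset\})$. For $\varepsilon, r, M > 0$ the rectifiability constant is $$R_E(\varepsilon,r,M) = \sup \frac{m(\{x \in J : x\omega_1 + (F(x)+y)\omega_2 \in E \text{ for some } -\varepsilon \le y \le \varepsilon\})}{m(J)},$$ the supremum over all orthonormal $\omega_1,\omega_2 \in S^1$, all $F:\mathbb{R}\to\mathbb{R}$ with Lipschitz constant at most $M$, and all intervals $J \subset \mathbb{R}$ of length at least $r$. *)

theory Defs
  imports "HOL-Analysis.Analysis"
begin

type_synonym pt = "real^2"

definition sph_content :: "real \<Rightarrow> real \<Rightarrow> pt set \<Rightarrow> ennreal" where
  "sph_content rm rp E = Inf {(\<integral>\<^sup>+ b. ennreal (diameter (ball (fst b) (snd b))) \<partial>count_space B) | B.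
      countable B \<and> (\<forall>b\<in>B. rm \<le> snd b \<and> snd b \<le> rp) \<and> E \<subseteq> (\<Union>b\<in>B. ball (fst b) (snd b))}"

definition sph_measure :: "pt set \<Rightarrow> ennreal" where
  "sph_measure E = Lim (at_right 0) (\<lambda>rp. sph_content 0 rp E)"

definition sigma_S1 :: "pt measure" where
  "sigma_S1 = distr (uniform_measure lborel {0..<2*pi}) borel (\<lambda>\<theta>. vector [cos \<theta>, sin \<theta>])"

definition favard :: "pt set \<Rightarrow> ennreal" where
  "favard E = emeasure (lborel \<Otimes>\<^sub>M sigma_S1) {(c, \<omega>). \<exists>x\<in>E. x \<bullet> \<omega> = c}"

definition rect_const :: "pt set \<Rightarrow> real \<Rightarrow> real \<Rightarrow> real \<Rightarrow> real" where
  "rect_const E \<epsilon> r M = Sup {measure lborel {x \<in> {a..b}. \<exists>y. -\<epsilon> \<le> y \<and> y \<le> \<epsilon> \<and>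
          x *\<^sub>R \<omega>1 + (F x + y) *\<^sub>R \<omega>2 \<in> E} / (b - a) | \<omega>1 \<omega>2 F a b.
      norm \<omega>1 = 1 \<and> norm \<omega>2 = 1 \<and> \<omega>1 \<bullet> \<omega>2 = 0 \<and> M-lipschitz_on UNIV F \<and> b - a \<ge> r}"

end

theory Submission
  imports Defs
begin

text \<open>
  Write \<open>q = N powr (1/100)\<close> and replace \<open>E\<close> by finitely many points \<open>x\<close> with weights, coming from a cover by
  extremely small balls; a set of points then projects to a set of measure at most twice its weight. Up to lines of
  measure \<open>O(L/q)\<close>, every line meets on average at most \<open>q\<close> balls of the cover at a given scale, and every tube around
  it has weight at most \<open>q\<close> times its width. Partition the circle of directions into dyadic arcs whose length at scale
  \<open>n\<close> is comparable with \<open>q r\<^sub>n\<close>. Call a direction at \<open>x\<close> bad at scale \<open>n\<close> if, seen with the resolution of scale \<open>n + g\<close>,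
  it points to another point at distance about \<open>r\<^sub>n\<close>, or lies in a heavy sector. A typical line is bad at few
  scales, since distinct bad scales produce distinct balls met by the line. A second moment (martingale) argument then
  shows that for most scales \<open>n\<close> bad directions even have small density in the whole arc of scale \<open>n\<close> around a
  typical direction, so that the cone over this arc has tiny weight. By Besicovitch's argument for cones, after
  deleting a set of small weight the points in each ball of scale \<open>n\<close> lie near the graph of a function with Lipschitz
  constant \<open>1 / r\<^sub>n\<close>; the rectifiability hypothesis bounds the projection of \<open>E\<close> near such a graph.
\<close>

section \<open>Combinatorial and covering lemmas\<close>

text \<open>The obstacle: a direction that is itself rarely bad may sit in densely bad arcs, while
  the cone bound needs the whole arc. The gap \<open>g\<close> is a compromise. A partner seen at
  resolution \<open>n + g\<close> is seen at all coarser ones, so one bad scale accounts for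
  \<open>g - 4\<close> counts of balls near the line, and at most about \<open>N * q / g\<close>
  scales are bad. But badness at \<open>n\<close> is then constant only on arcs of level
  \<open>a (n + g)\<close>, so orthogonality needs scales \<open>g\<close> apart and the second
  moment loses a factor \<open>g\<close>. The constants are solved backwards. Deleting weight at
  most \<open>snd b / q\<close> per ball asks for \<open>\<eta>\<close> at most
  \<open>1 / (1024 * pi * q ^ 3)\<close>; \<open>1 / q ^ 4\<close> does, since
  \<open>4000 \<le> q\<close>. Being dense at a proportion \<open>1 / q\<close> of the scales must
  clash with having few bad scales, which asks for \<open>g\<close> of order \<open>q ^ 7\<close>.
  Exceptional directions of proportion \<open>1 / q\<close> then ask for about
  \<open>g * q ^ 11\<close>, that is \<open>q ^ 18\<close>, scales, and
  \<open>q ^ 20 \<le> N\<close> provides them. Finally one scale that serves most points and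
  directions is found by averaging.\<close>

lemma finite_vitali_real:
  fixes u r :: "'a \<Rightarrow> real"
  assumes "finite A" and "\<And>i. i \<in> A \<Longrightarrow> 0 \<le> r i"
  obtains D where "D \<subseteq> A"
    and "\<And>i j. i \<in> D \<Longrightarrow> j \<in> D \<Longrightarrow> i \<noteq> j \<Longrightarrow> r i + r j < \<bar>u i - u j\<bar>"
    and "\<And>i. i \<in> A \<Longrightarrow> \<exists>j\<in>D. \<bar>u i - u j\<bar> \<le> 2 * r j"
proof -
  have "\<exists>D\<subseteq>A. (\<forall>i\<in>D. \<forall>j\<in>D. i \<noteq> j \<longrightarrow> r i + r j < \<bar>u i - u j\<bar>) \<and>
      (\<forall>i\<in>A. \<exists>j\<in>D. \<bar>u i - u j\<bar> \<le> r i + r j \<and> r i \<le> r j)"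
    using assms
  proof (induction A rule: finite_psubset_induct)
    case (psubset A)
    show ?case
    proof (cases "A = {}")
      case True then show ?thesis by auto
    next
      case False
      \<comment> \<open>Greedy selection: keep an interval of largest radius, discard all that meet
        it, recurse. A discarded one has radius at most \<open>r m\<close>, so its centre is within
        \<open>2 * r m\<close> of \<open>u m\<close>; covering the centres is all that is used
        later.\<close>
      then obtain m where m: "m \<in> A" "\<forall>i\<in>A. r i \<le> r m"
        using obtains_MAX[OF psubset(1) False, of r] by (metis Max_ge finite_imageI image_eqI psubset.hyps)
      define A' where "A' = {i\<in>A. r i + r m < \<bar>u i - u m\<bar>}"
      have "m \<notin> A'" using psubset.prems[OF m(1)] by (auto simp: A'_def)
      moreover have "A' \<subseteq> A" by (auto simp: A'_def)
      ultimately have "A' \<subset> A" using m by auto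
      then obtain D where D: "D \<subseteq> A'" "\<forall>i\<in>D. \<forall>j\<in>D. i \<noteq> j \<longrightarrow> r i + r j < \<bar>u i - u j\<bar>"
        "\<forall>i\<in>A'. \<exists>j\<in>D. \<bar>u i - u j\<bar> \<le> r i + r j \<and> r i \<le> r j"
        using psubset.IH[of A'] psubset.prems by (auto simp: A'_def)
      show ?thesis
      proof (intro exI[of _ "insert m D"] conjI ballI impI)
        show "insert m D \<subseteq> A" using D m \<open>A' \<subset> A\<close> by auto
        show "r i + r j < \<bar>u i - u j\<bar>" if "i \<in> insert m D" "j \<in> insert m D" "i \<noteq> j" for i j
          using that D unfolding A'_def by (force simp: abs_minus_commute add.commute)
        show "\<exists>j\<in>insert m D. \<bar>u i - u j\<bar> \<le> r i + r j \<and> r i \<le> r j" if "i \<in> A" for i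
          using that D m unfolding A'_def by force
      qed
    qed
  qed
  then obtain D where D: "D \<subseteq> A" "\<forall>i\<in>D. \<forall>j\<in>D. i \<noteq> j \<longrightarrow> r i + r j < \<bar>u i - u j\<bar>"
    "\<forall>i\<in>A. \<exists>j\<in>D. \<bar>u i - u j\<bar> \<le> r i + r j \<and> r i \<le> r j" by blast
  show ?thesis
  proof (rule that[OF D(1)])
    show "\<exists>j\<in>D. \<bar>u i - u j\<bar> \<le> 2 * r j" if "i \<in> A" for i
      using bspec[OF D(3) that] by force
  qed (use D in auto)
qed

lemma sum_disjoint_radii_le:
  fixes u r :: "'a \<Rightarrow> real"
  assumes "finite D" and "\<And>i j. i \<in> D \<Longrightarrow> j \<in> D \<Longrightarrow> i \<noteq> j \<Longrightarrow> r i + r j < \<bar>u i - u j\<bar>"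
    and "\<And>i. i \<in> D \<Longrightarrow> 0 \<le> r i" and "\<And>i. i \<in> D \<Longrightarrow> {u i - r i..u i + r i} \<subseteq> {c..d}" and "c \<le> d"
  shows "(\<Sum>i\<in>D. 2 * r i) \<le> d - c"
proof -
  have "disjoint_family_on (\<lambda>i. {u i - r i..u i + r i}) D"
    unfolding disjoint_family_on_def
  proof (intro ballI impI)
    fix i j assume "i \<in> D" "j \<in> D" "i \<noteq> j"
    from assms(2)[OF this] assms(3)[of i] assms(3)[of j] \<open>i \<in> D\<close> \<open>j \<in> D\<close>
    show "{u i - r i..u i + r i} \<inter> {u j - r j..u j + r j} = {}" by auto
  qed
  then have "measure lborel (\<Union>i\<in>D. {u i - r i..u i + r i}) = (\<Sum>i\<in>D. measure lborel {u i - r i..u i + r i})"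
    using assms(1) by (intro measure_finite_Union) (auto simp: emeasure_lborel_Icc_eq)
  also have "\<dots> = (\<Sum>i\<in>D. 2 * r i)" using assms(3) by (intro sum.cong) auto
  finally have "(\<Sum>i\<in>D. 2 * r i) = measure lborel (\<Union>i\<in>D. {u i - r i..u i + r i})" ..
  also have "\<dots> \<le> measure lborel {c..d}"
    using assms(1,4) by (intro measure_mono_fmeasurable UN_least sets.finite_UN) (auto simp: fmeasurable_def emeasure_lborel_Icc_eq)
  finally show ?thesis using assms(5) by simp
qed

text \<open>Orthogonality: \<open>f n\<close> sums to zero over every cell of \<open>c n\<close>, while \<open>f m\<close> is constant
  on these cells once \<open>m + g \<le> n\<close>.\<close>

lemma few_bad_many_dense_card:
  fixes c :: "nat \<Rightarrow> 'a \<Rightarrow> 'b" and bad :: "nat \<Rightarrow> 'a \<Rightarrow> bool" and \<eta> \<tau> \<kappa> :: real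
  assumes T: "finite T" and S: "finite S"
    and refine: "\<And>m n i j. m \<in> S \<Longrightarrow> n \<in> S \<Longrightarrow> m + g \<le> n \<Longrightarrow> i \<in> T \<Longrightarrow> j \<in> T \<Longrightarrow> c n i = c n j \<Longrightarrow>
       c m i = c m j \<and> bad m i = bad m j"
    and X: "\<And>n i. n \<in> S \<Longrightarrow> i \<in> T \<Longrightarrow> X n i \<longleftrightarrow>
       \<eta> * card {j\<in>T. c n j = c n i} < card {j\<in>T. c n j = c n i \<and> bad n j}"
    and \<kappa>: "\<kappa> \<le> \<eta> * \<tau>" and \<eta>: "0 \<le> \<eta>" and g: "0 < g"
  shows "card {i\<in>T. card {n\<in>S. bad n i} \<le> \<kappa> \<and> \<tau> \<le> card {n\<in>S. X n i}} * (\<eta> * \<tau> - \<kappa>)\<^sup>2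
     \<le> card T * (2 * real g * card S)"
proof -
  define d where "d n i = card {j\<in>T. c n j = c n i \<and> bad n j} / card {j\<in>T. c n j = c n i}" for n i
  \<comment> \<open>Excess of \<open>bad\<close> over its cell average, kept on dense cells only.
    There the average exceeds \<open>\<eta>\<close>, so a point with few bad but many dense scales
    makes the sum of \<open>f n i\<close> over \<open>n\<close> strongly negative; Chebyshev's
    inequality then bounds the number of such points.\<close>
  define f where "f n i = of_bool (X n i) * (of_bool (bad n i) - d n i)" for n i
  have cpos: "card {j\<in>T. c n j = c n i} > 0" if "i \<in> T" for n i
    using that T by (auto simp: card_gt_0_iff)
  have d01: "0 \<le> d n i" "d n i \<le> 1" if "i \<in> T" for n i
  proof -
    show "0 \<le> d n i" by (simp add: d_def)
    have "card {j\<in>T. c n j = c n i \<and> bad n j} \<le> card {j\<in>T. c n j = c n i}"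
      using T by (intro card_mono) auto
    then show "d n i \<le> 1" using cpos[OF that, of n] by (simp add: d_def)
  qed
  have f1: "\<bar>f n i\<bar> \<le> 1" if "i \<in> T" for n i
    using d01[OF that, of n] by (auto simp: f_def)
  have cell0: "(\<Sum>j\<in>{j\<in>T. c n j = z}. f n j) = 0" if "n \<in> S" for n z
  proof (cases "\<exists>i\<in>T. c n i = z")
    case False
    then have "{j\<in>T. c n j = z} = {}" by auto
    then show ?thesis by (simp only: sum.empty)
  next
    case True
    then obtain i where i: "i \<in> T" "c n i = z" by auto
    have "(\<Sum>j\<in>{j\<in>T. c n j = z}. f n j) = (\<Sum>j\<in>{j\<in>T. c n j = z}. of_bool (X n i) * (of_bool (bad n j) - d n i))"
      using X that i by (intro sum.cong) (auto simp: f_def d_def)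
    also have "\<dots> = of_bool (X n i) * ((\<Sum>j\<in>{j\<in>T. c n j = z}. of_bool (bad n j)) - card {j\<in>T. c n j = z} * d n i)"
      by (simp add: sum_distrib_left sum_subtractf)
    also have "(\<Sum>j\<in>{j\<in>T. c n j = z}. of_bool (bad n j) :: real) = card {j\<in>T. c n j = z \<and> bad n j}"
    proof -
      have "{j\<in>T. c n j = z \<and> bad n j} = {j\<in>T. c n j = z} \<inter> {j. bad n j}" by auto
      then show ?thesis using T by simp
    qed
    also have "card {j\<in>T. c n j = z} * d n i = card {j\<in>T. c n j = z \<and> bad n j}"
      using cpos[OF i(1), of n] i by (simp add: d_def)
    finally show ?thesis by simp
  qed
  have orth: "(\<Sum>i\<in>T. f m i * f n i) = 0" if mn: "m \<in> S" "n \<in> S" "m + g \<le> n" for m n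
  proof -
    have fconst: "f m i = f m j" if "i \<in> T" "j \<in> T" "c n i = c n j" for i j
      using refine[OF mn that] X[OF mn(1)] that by (auto simp: f_def d_def)
    have "(\<Sum>i\<in>T. f m i * f n i) = (\<Sum>z\<in>c n ` T. \<Sum>i\<in>{i\<in>T. c n i = z}. f m i * f n i)"
      using T by (rule sum.image_gen)
    also have "\<dots> = (\<Sum>z\<in>c n ` T. 0)"
    proof (intro sum.cong refl)
      fix z assume "z \<in> c n ` T"
      then obtain k where k: "k \<in> T" "c n k = z" by auto
      have "(\<Sum>i\<in>{i\<in>T. c n i = z}. f m i * f n i) = (\<Sum>i\<in>{i\<in>T. c n i = z}. f m k * f n i)"
      proof (intro sum.cong refl)
        fix i assume "i \<in> {i\<in>T. c n i = z}"
        with fconst[of i k] k show "f m i * f n i = f m k * f n i" by auto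
      qed
      also have "\<dots> = 0" using cell0[OF mn(2)] by (simp flip: sum_distrib_left)
      finally show "(\<Sum>i\<in>{i\<in>T. c n i = z}. f m i * f n i) = 0" .
    qed
    finally show ?thesis by simp
  qed
  define G where "G = {i\<in>T. card {n\<in>S. bad n i} \<le> \<kappa> \<and> \<tau> \<le> card {n\<in>S. X n i}}"
  have low: "(\<eta> * \<tau> - \<kappa>)\<^sup>2 \<le> (\<Sum>n\<in>S. f n i)\<^sup>2" if "i \<in> G" for i
  proof -
    have i: "i \<in> T" "card {n\<in>S. bad n i} \<le> \<kappa>" "\<tau> \<le> card {n\<in>S. X n i}" using that by (auto simp: G_def)
    have "(\<Sum>n\<in>S. f n i) \<le> (\<Sum>n\<in>S. of_bool (bad n i) - \<eta> * of_bool (X n i))"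
    proof (intro sum_mono)
      fix n assume "n \<in> S"
      then have "X n i \<Longrightarrow> \<eta> \<le> d n i" using X i(1) cpos[OF i(1), of n] by (auto simp: d_def field_simps)
      then show "f n i \<le> of_bool (bad n i) - \<eta> * of_bool (X n i)" by (auto simp: f_def)
    qed
    also have "\<dots> = card {n\<in>S. bad n i} - \<eta> * card {n\<in>S. X n i}"
      using S by (simp add: sum_subtractf flip: sum_distrib_left) (simp add: Int_def)
    also have "\<dots> \<le> \<kappa> - \<eta> * \<tau>" using i mult_left_mono[OF i(3) \<eta>] by linarith
    finally have "\<eta> * \<tau> - \<kappa> \<le> \<bar>\<Sum>n\<in>S. f n i\<bar>" by linarith
    then have "(\<eta> * \<tau> - \<kappa>)\<^sup>2 \<le> \<bar>\<Sum>n\<in>S. f n i\<bar>\<^sup>2" using \<kappa> by (intro power_mono) auto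
    then show ?thesis by simp
  qed
  have "card G * (\<eta> * \<tau> - \<kappa>)\<^sup>2 = (\<Sum>i\<in>G. (\<eta> * \<tau> - \<kappa>)\<^sup>2)" by simp
  also have "\<dots> \<le> (\<Sum>i\<in>G. (\<Sum>n\<in>S. f n i)\<^sup>2)" using low by (intro sum_mono) auto
  also have "\<dots> \<le> (\<Sum>i\<in>T. (\<Sum>n\<in>S. f n i)\<^sup>2)" using T by (intro sum_mono2) (auto simp: G_def)
  also have "\<dots> = (\<Sum>m\<in>S. \<Sum>n\<in>S. \<Sum>i\<in>T. f m i * f n i)"
    unfolding power2_eq_square sum_product
    by (subst sum.swap) (intro sum.cong refl sum.swap)
  \<comment> \<open>Orthogonality leaves only the pairs closer than \<open>g\<close>, which are
    bounded trivially. The lower end \<open>m + 1 - g\<close> is cut off at 0 by natural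
    subtraction, which only shortens the window.\<close>
  also have "\<dots> \<le> (\<Sum>m\<in>S. \<Sum>n\<in>S. real (card T) * of_bool (n \<in> {m + 1 - g..<m + g}))"
  proof (intro sum_mono)
    fix m n assume mn: "m \<in> S" "n \<in> S"
    consider "m + g \<le> n" | "n + g \<le> m" | "n \<in> {m + 1 - g..<m + g}" by fastforce
    then show "(\<Sum>i\<in>T. f m i * f n i) \<le> real (card T) * of_bool (n \<in> {m + 1 - g..<m + g})"
    proof cases
      case 1 then show ?thesis using orth[OF mn] by simp
    next
      case 2 then show ?thesis using orth[OF mn(2,1)] by (simp add: mult.commute)
    next
      case 3
      have "(\<Sum>i\<in>T. f m i * f n i) \<le> (\<Sum>i\<in>T. 1)"
      proof (intro sum_mono)
        fix i assume "i \<in> T"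
        have "\<bar>f m i\<bar> * \<bar>f n i\<bar> \<le> 1 * 1" using f1[OF \<open>i \<in> T\<close>] by (intro mult_mono) auto
        then show "f m i * f n i \<le> 1" by (metis abs_le_D1 abs_mult mult_1)
      qed
      then show ?thesis using 3 by simp
    qed
  qed
  also have "\<dots> = card T * (\<Sum>m\<in>S. real (card (S \<inter> {m + 1 - g..<m + g})))"
  proof -
    have "(\<Sum>n\<in>S. real (card T) * of_bool (n \<in> Z)) = card T * real (card (S \<inter> Z))" for Z
      using S by (simp flip: sum_distrib_left)
    then show ?thesis by (simp only: sum_distrib_left)
  qed
  also have "\<dots> \<le> card T * (\<Sum>m\<in>S. 2 * real g)"
  proof (intro mult_left_mono sum_mono)
    fix m
    have "card (S \<inter> {m + 1 - g..<m + g}) \<le> card {m + 1 - g..<m + g}" by (intro card_mono) auto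
    also have "\<dots> \<le> 2 * g" by simp
    finally show "real (card (S \<inter> {m + 1 - g..<m + g})) \<le> 2 * real g"
      by (metis of_nat_le_iff of_nat_mult of_nat_numeral)
  qed auto
  finally show ?thesis by (simp add: G_def mult_ac)
qed

text \<open>Each fibre lies in a window of \<open>k\<close> consecutive integers starting at its
  minimum.\<close>

lemma card_le_fibres:
  fixes f :: "nat \<Rightarrow> 'b"
  assumes "finite A" and "0 < k" and "\<And>m n. m \<in> A \<Longrightarrow> n \<in> A \<Longrightarrow> f m = f n \<Longrightarrow> m < n \<Longrightarrow> n < m + k"
  shows "card A \<le> k * card (f ` A)"
proof -
  have "card A = (\<Sum>z\<in>f ` A. card {n\<in>A. f n = z})"
    using sum.image_gen[OF assms(1), of "\<lambda>_. 1::nat" f] by simp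
  also have "\<dots> \<le> (\<Sum>z\<in>f ` A. k)"
  proof (intro sum_mono)
    fix z assume "z \<in> f ` A"
    define m where "m = Min {n\<in>A. f n = z}"
    have fin: "finite {n\<in>A. f n = z}" and ne: "{n\<in>A. f n = z} \<noteq> {}" using assms(1) \<open>z \<in> f ` A\<close> by auto
    have m: "m \<in> A" "f m = z" using Min_in[OF fin ne] by (auto simp: m_def)
    have "{n\<in>A. f n = z} \<subseteq> {m..<m + k}"
    proof
      fix n assume n: "n \<in> {n\<in>A. f n = z}"
      then have "m \<le> n" using fin by (simp add: m_def)
      then show "n \<in> {m..<m + k}" using assms(2) assms(3)[of m n] m n by (cases "m = n") auto
    qed
    then have "card {n\<in>A. f n = z} \<le> card {m..<m + k}" by (intro card_mono) auto
    then show "card {n\<in>A. f n = z} \<le> k" by simp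
  qed
  finally show ?thesis by (simp add: mult.commute)
qed

lemma card_mod_le:
  fixes m k :: nat
  assumes "A \<subseteq> {..<m}"
  shows "card {l. l < k * m \<and> l mod m \<in> A} \<le> k * card A"
proof -
  have "finite A" using assms finite_subset by blast
  have "card {l. l < k * m \<and> l mod m \<in> A} \<le> card ({..<k} \<times> A)"
  proof (rule card_inj_on_le[where f = "\<lambda>l. (l div m, l mod m)"])
    show "inj_on (\<lambda>l. (l div m, l mod m)) {l. l < k * m \<and> l mod m \<in> A}"
      by (intro inj_onI) (metis Pair_inject div_mult_mod_eq)
    show "(\<lambda>l. (l div m, l mod m)) ` {l. l < k * m \<and> l mod m \<in> A} \<subseteq> {..<k} \<times> A"
      by (auto simp: less_mult_imp_div_less)
  qed (use \<open>finite A\<close> in auto)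
  then show ?thesis by (simp add: card_cartesian_product)
qed

lemma card_div_eq:
  fixes m i :: nat assumes "0 < m"
  shows "finite {l. l div m = i}" "card {l. l div m = i} = m"
proof -
  have "{l. l div m = i} = {i * m..<i * m + m}"
    using assms by (auto simp: div_nat_eqI dividend_less_times_div div_times_less_eq_dividend mult.commute add.commute)
  then show "finite {l. l div m = i}" "card {l. l div m = i} = m" by simp_all
qed

text \<open>If exactly one of the two halves of a dyadic cell consists of bad leaves only, then the
  cell is at most twice as long as its bad part, and it still contains a good leaf that controls \<open>M\<close> on it.\<close>

lemma dyadic_mass_le_bad:
  fixes M :: "nat \<Rightarrow> nat \<Rightarrow> real" and \<kappa> :: real
  assumes A: "a \<le> A" "A \<le> \<Lambda>" and \<kappa>: "0 \<le> \<kappa>"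
    and sub: "\<And>b i. a \<le> b \<Longrightarrow> b < A \<Longrightarrow> M b i \<le> M (Suc b) (2 * i) + M (Suc b) (2 * i + 1)"
    and leaf: "\<And>l. \<not> bad l \<Longrightarrow> M A (l div 2 ^ (\<Lambda> - A)) \<le> 0"
    and anc: "\<And>l b. \<not> bad l \<Longrightarrow> a \<le> b \<Longrightarrow> b \<le> A \<Longrightarrow> M b (l div 2 ^ (\<Lambda> - b)) \<le> \<kappa> * 2 ^ (\<Lambda> - b)"
    and b: "a \<le> b" "b \<le> A" and l: "l div 2 ^ (\<Lambda> - b) = i" "\<not> bad l"
  shows "M b i \<le> 2 * \<kappa> * card {l. l div 2 ^ (\<Lambda> - b) = i \<and> bad l}"
  using b(2,1) l
proof (induction b arbitrary: i l rule: inc_induct)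
  case base
  then show ?case using leaf \<kappa> by (metis (no_types) mult_nonneg_nonneg of_nat_0_le_iff order_trans zero_le_numeral)
next
  case (step b)
  define m where "m = (2::nat) ^ (\<Lambda> - Suc b)"
  have m: "0 < m" "2 ^ (\<Lambda> - b) = 2 * m"
  proof -
    show "0 < m" by (simp add: m_def)
    have "\<Lambda> - b = Suc (\<Lambda> - Suc b)" using step.hyps A by simp
    then show "2 ^ (\<Lambda> - b) = 2 * m" by (simp add: m_def)
  qed
  have split: "l div (2 * m) = i \<longleftrightarrow> l div m = 2 * i \<or> l div m = 2 * i + 1" for l
  proof -
    have "l div (2 * m) = l div m div 2" by (metis div_mult2_eq mult.commute)
    moreover have "k div 2 = i \<longleftrightarrow> k = 2 * i \<or> k = 2 * i + 1" for k by auto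
    ultimately show ?thesis by metis
  qed
  define c where "c j = {l. l div m = j \<and> bad l}" for j
  have fin: "finite (c j)" for j using card_div_eq(1)[OF m(1), of j] by (auto simp: c_def elim: rev_finite_subset)
  have "{l. l div 2 ^ (\<Lambda> - b) = i \<and> bad l} = c (2 * i) \<union> c (2 * i + 1)"
    unfolding m split c_def by auto
  moreover have "c (2 * i) \<inter> c (2 * i + 1) = {}" by (auto simp: c_def)
  ultimately have card: "card {l. l div 2 ^ (\<Lambda> - b) = i \<and> bad l} = card (c (2 * i)) + card (c (2 * i + 1))"
    using fin by (simp add: card_Un_disjoint)
  have IH: "M (Suc b) j \<le> 2 * \<kappa> * card (c j)" if "l' div m = j" "\<not> bad l'" for l' j
    using step.IH[of l' j] step.prems that unfolding c_def m_def by auto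
  have full: "card (c j) = m" if "\<And>l'. l' div m = j \<Longrightarrow> bad l'" for j
  proof -
    have "c j = {l. l div m = j}" using that by (auto simp: c_def)
    then show ?thesis using card_div_eq(2)[OF m(1)] by simp
  qed
  show ?case
  proof (cases "\<exists>j\<in>{2 * i, 2 * i + 1}. \<forall>l'. l' div m = j \<longrightarrow> bad l'")
    case True
    then have "m \<le> card (c (2 * i)) + card (c (2 * i + 1))" using full by fastforce
    then have "2 * real m \<le> 2 * card {l. l div 2 ^ (\<Lambda> - b) = i \<and> bad l}" unfolding card by simp
    then have "\<kappa> * (2 * real m) \<le> \<kappa> * (2 * card {l. l div 2 ^ (\<Lambda> - b) = i \<and> bad l})"
      using \<kappa> by (rule mult_left_mono)
    moreover have "M b i \<le> \<kappa> * (2 * real m)"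
    proof -
      have "real (2 ^ (\<Lambda> - b)) = real (2 * m)" using m(2) by simp
      then have "(2::real) ^ (\<Lambda> - b) = 2 * real m" by simp
      then show ?thesis using anc[OF step.prems(3,1)] step.hyps step.prems by simp
    qed
    ultimately show ?thesis by (simp add: mult_ac)
  next
    case False
    then have "M (Suc b) (2 * i) \<le> 2 * \<kappa> * card (c (2 * i))" "M (Suc b) (2 * i + 1) \<le> 2 * \<kappa> * card (c (2 * i + 1))"
      using IH by blast+
    then show ?thesis using sub[OF step.prems(1) step.hyps(2)] unfolding card by (simp add: algebra_simps) (meson order_trans add_mono)
  qed
qed

section \<open>Light cones\<close>

text \<open>A point with a partner inside the vertical cone of aperture \<open>r\<close> sits in a strip around a segment
  of height \<open>h\<close>; that strip is covered by the cones at the two endpoints of the segment, hence is light.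
  Deleting all such points (\<open>U\<close>) leaves a Lipschitz graph up to \<open>\<epsilon>\<close>.\<close>

lemma light_cones_imp_lipschitz:
  fixes u v w :: "'a \<Rightarrow> real" and r \<epsilon> \<rho> \<Gamma> u0 :: real
  assumes R: "finite R" and w: "\<And>i. i \<in> R \<Longrightarrow> 0 \<le> w i"
    and r: "0 < r" "r \<le> 1" and \<epsilon>: "0 < \<epsilon>" and \<rho>: "0 < \<rho>" and \<Gamma>: "0 \<le> \<Gamma>"
    and u: "\<And>i. i \<in> R \<Longrightarrow> \<bar>u i - u0\<bar> \<le> \<rho>"
    and v: "\<And>i j. i \<in> R \<Longrightarrow> j \<in> R \<Longrightarrow> \<bar>v i - v j\<bar> \<le> 2 * \<rho>"
    and mass: "\<And>i h. i \<in> R \<Longrightarrow> \<epsilon> < h \<Longrightarrow> h \<le> 2 * \<rho> \<Longrightarrow>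
      sum w {j\<in>R. h/2 \<le> \<bar>v j - v i\<bar> \<and> \<bar>v j - v i\<bar> \<le> 3/2 * h \<and> \<bar>u j - u i\<bar> \<le> 5/2 * r * \<bar>v j - v i\<bar>} \<le> \<Gamma> * h"
  obtains F U where "(1/r)-lipschitz_on UNIV F" "U \<subseteq> R" "sum w U \<le> 32 * \<Gamma> * \<rho> / r"
    "\<And>i. i \<in> R - U \<Longrightarrow> \<bar>v i - F (u i)\<bar> \<le> \<epsilon> / 2"
proof -
  define pair where "pair i j \<longleftrightarrow> \<bar>u j - u i\<bar> < r * \<bar>v j - v i\<bar> \<and> \<epsilon> < \<bar>v j - v i\<bar>" for i j
  define U where "U = {i\<in>R. \<exists>j\<in>R. pair i j}"
  have UR: "U \<subseteq> R" "finite U" using R by (auto simp: U_def)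
  \<comment> \<open>Taking the farthest partner confines the strip vertically: a point in the cone
    at \<open>i\<close> beyond height \<open>h i\<close> would be a farther partner.\<close>
  define h where "h i = Max ((\<lambda>j. \<bar>v j - v i\<bar>) ` {j\<in>R. pair i j})" for i
  have hmax: "\<bar>v j - v i\<bar> \<le> h i" if "i \<in> U" "j \<in> R" "pair i j" for i j
    unfolding h_def using that R by (intro Max_ge) auto
  have hex: "\<exists>j\<in>R. pair i j \<and> h i = \<bar>v j - v i\<bar>" if "i \<in> U" for i
  proof -
    have "h i \<in> (\<lambda>j. \<bar>v j - v i\<bar>) ` {j\<in>R. pair i j}"
      unfolding h_def using that R by (intro Max_in) (auto simp: U_def)
    then show ?thesis by auto
  qed
  have h: "\<epsilon> < h i" "h i \<le> 2 * \<rho>" if "i \<in> U" for i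
    using hex[OF that] v that UR by (auto simp: pair_def)
  \<comment> \<open>Points within \<open>2 * \<sigma> i = r * h i / 4\<close> horizontally and at
    least \<open>h i / 2\<close> away vertically are well inside the cone of aperture
    \<open>r\<close> at \<open>i\<close>. The Vitali selection makes the intervals of radius
    \<open>\<sigma>\<close> disjoint, and their total length is what bounds the sum of the
    \<open>h i\<close>.\<close>
  define \<sigma> where "\<sigma> i = r * h i / 8" for i
  have \<sigma>: "0 \<le> \<sigma> i" "\<sigma> i \<le> \<rho>" if "i \<in> U" for i
  proof -
    show "0 \<le> \<sigma> i" using h[OF that] r \<epsilon> by (simp add: \<sigma>_def)
    have "r * h i \<le> 1 * (2 * \<rho>)" using h[OF that] r \<epsilon> by (intro mult_mono) auto
    then show "\<sigma> i \<le> \<rho>" using \<rho> by (simp add: \<sigma>_def)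
  qed
  obtain D where D: "D \<subseteq> U" "\<And>i j. i \<in> D \<Longrightarrow> j \<in> D \<Longrightarrow> i \<noteq> j \<Longrightarrow> \<sigma> i + \<sigma> j < \<bar>u i - u j\<bar>"
    "\<And>i. i \<in> U \<Longrightarrow> \<exists>j\<in>D. \<bar>u i - u j\<bar> \<le> 2 * \<sigma> j"
    by (rule finite_vitali_real[where A = U and r = \<sigma> and u = u]) (use UR \<sigma> in auto)
  have finD: "finite D" using D(1) UR(2) finite_subset by blast
  have strip: "sum w {z\<in>U. \<bar>u z - u i\<bar> \<le> 2 * \<sigma> i} \<le> 2 * \<Gamma> * h i" if "i \<in> D" for i
  proof -
    have iU: "i \<in> U" and iR: "i \<in> R" using that D UR by auto
    obtain j where j: "j \<in> R" "pair i j" "h i = \<bar>v j - v i\<bar>" using hex[OF iU] by auto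
    define K where "K k = {z\<in>R. h i/2 \<le> \<bar>v z - v k\<bar> \<and> \<bar>v z - v k\<bar> \<le> 3/2 * h i \<and> \<bar>u z - u k\<bar> \<le> 5/2 * r * \<bar>v z - v k\<bar>}" for k
    have "{z\<in>U. \<bar>u z - u i\<bar> \<le> 2 * \<sigma> i} \<subseteq> K i \<union> K j"
    proof
      fix z assume "z \<in> {z\<in>U. \<bar>u z - u i\<bar> \<le> 2 * \<sigma> i}"
      then have z: "z \<in> R" "\<bar>u z - u i\<bar> \<le> r * h i / 4" using UR by (auto simp: \<sigma>_def)
      have rh: "0 < r * h i" using r h[OF iU] \<epsilon> by simp
      show "z \<in> K i \<union> K j"
      proof (cases "h i / 2 \<le> \<bar>v z - v i\<bar>")
        case True
        have "r * (h i / 2) \<le> r * \<bar>v z - v i\<bar>" using True r by (intro mult_left_mono) auto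
        then have less: "\<bar>u z - u i\<bar> < r * \<bar>v z - v i\<bar>" using z rh by simp
        have "\<bar>v z - v i\<bar> \<le> h i"
        proof (rule ccontr)
          assume big: "\<not> ?thesis"
          then have "pair i z" using less h[OF iU] by (auto simp: pair_def)
          then show False using hmax[OF iU z(1)] big by auto
        qed
        moreover have "\<bar>u z - u i\<bar> \<le> 5/2 * r * \<bar>v z - v i\<bar>"
          using less mult_nonneg_nonneg[of r "\<bar>v z - v i\<bar>"] r by linarith
        ultimately have "z \<in> K i" using True z h[OF iU] \<epsilon> by (auto simp: K_def)
        then show ?thesis by simp
      next
        \<comment> \<open>Now \<open>z\<close> is at least \<open>h i / 2\<close> away from the
          partner \<open>j\<close> in height, and horizontally at most
          \<open>r * h i / 4 + r * h i\<close>. This explains the wider aperture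
          \<open>5/2 * r\<close> and the upper limit \<open>3/2 * h\<close> in the hypothesis on
          cones.\<close>
        case False
        have 1: "h i / 2 \<le> \<bar>v z - v j\<bar>" "\<bar>v z - v j\<bar> \<le> 3/2 * h i" using False j(3) by linarith+
        have "\<bar>u z - u j\<bar> \<le> 5/4 * (r * h i)" using z(2) j(2) unfolding pair_def j(3)[symmetric] by linarith
        also have "\<dots> \<le> 5/2 * r * \<bar>v z - v j\<bar>" using mult_left_mono[OF 1(1), of r] r by simp
        finally have "z \<in> K j" using 1 z by (auto simp: K_def)
        then show ?thesis by simp
      qed
    qed
    then have "sum w {z\<in>U. \<bar>u z - u i\<bar> \<le> 2 * \<sigma> i} \<le> sum w (K i \<union> K j)"
      using R w UR by (intro sum_mono2) (auto simp: K_def)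
    also have "\<dots> \<le> sum w (K i) + sum w (K j)"
    proof -
      have "0 \<le> sum w (K i \<inter> K j)" using w by (intro sum_nonneg) (auto simp: K_def)
      moreover have "finite (K i)" "finite (K j)" using R by (auto simp: K_def)
      ultimately show ?thesis using sum.union_inter[of "K i" "K j" w] by linarith
    qed
    also have "\<dots> \<le> \<Gamma> * h i + \<Gamma> * h i"
      using mass[OF iR h[OF iU]] mass[OF j(1) h[OF iU]] unfolding K_def by linarith
    finally show ?thesis by simp
  qed
  have "sum w U \<le> sum w (\<Union>i\<in>D. {z\<in>U. \<bar>u z - u i\<bar> \<le> 2 * \<sigma> i})"
    using D w UR finD by (intro sum_mono2) auto
  also have "\<dots> \<le> (\<Sum>i\<in>D. sum w {z\<in>U. \<bar>u z - u i\<bar> \<le> 2 * \<sigma> i})"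
  proof -
    have "sum w (\<Union>i\<in>D'. {z\<in>U. \<bar>u z - u i\<bar> \<le> 2 * \<sigma> i}) \<le> (\<Sum>i\<in>D'. sum w {z\<in>U. \<bar>u z - u i\<bar> \<le> 2 * \<sigma> i})"
      if "finite D'" for D'
      using that
    proof (induction D')
      case (insert x D')
      let ?A = "{z\<in>U. \<bar>u z - u x\<bar> \<le> 2 * \<sigma> x}" and ?B = "\<Union>i\<in>D'. {z\<in>U. \<bar>u z - u i\<bar> \<le> 2 * \<sigma> i}"
      have "0 \<le> sum w (?A \<inter> ?B)" using w UR by (intro sum_nonneg) auto
      moreover have "sum w (?A \<union> ?B) + sum w (?A \<inter> ?B) = sum w ?A + sum w ?B"
        using UR insert by (intro sum.union_inter) auto
      ultimately show ?case using insert by simp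
    qed simp
    then show ?thesis using finD by blast
  qed
  also have "\<dots> \<le> (\<Sum>i\<in>D. 8 * \<Gamma> / r * (2 * \<sigma> i))"
  proof (intro sum_mono)
    fix i assume "i \<in> D"
    have "8 * \<Gamma> / r * (2 * \<sigma> i) = 2 * \<Gamma> * h i" using r by (simp add: \<sigma>_def)
    then show "sum w {z\<in>U. \<bar>u z - u i\<bar> \<le> 2 * \<sigma> i} \<le> 8 * \<Gamma> / r * (2 * \<sigma> i)"
      using strip[OF \<open>i \<in> D\<close>] by simp
  qed
  also have "\<dots> = 8 * \<Gamma> / r * (\<Sum>i\<in>D. 2 * \<sigma> i)" by (simp only: sum_distrib_left)
  also have "\<dots> \<le> 8 * \<Gamma> / r * (4 * \<rho>)"
  proof (intro mult_left_mono)
    have "(\<Sum>i\<in>D. 2 * \<sigma> i) \<le> (u0 + 2 * \<rho>) - (u0 - 2 * \<rho>)"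
    proof (intro sum_disjoint_radii_le[OF finD D(2)])
      show "{u i - \<sigma> i..u i + \<sigma> i} \<subseteq> {u0 - 2 * \<rho>..u0 + 2 * \<rho>}" if "i \<in> D" for i
      proof -
        have "i \<in> U" "i \<in> R" using that D UR by auto
        then show ?thesis using \<sigma>[of i] u[of i] by auto
      qed
    qed (use \<sigma> D \<rho> in auto)
    then show "(\<Sum>i\<in>D. 2 * \<sigma> i) \<le> 4 * \<rho>" by simp
  qed (use \<Gamma> r in auto)
  finally have massU: "sum w U \<le> 32 * \<Gamma> * \<rho> / r" by simp
  define Q where "Q = R - U"
  have Q: "\<bar>v i - v j\<bar> \<le> 1/r * \<bar>u i - u j\<bar> + \<epsilon>" if "i \<in> Q" "j \<in> Q" for i j
  proof (rule ccontr)
    assume a: "\<not> ?thesis"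
    then have "\<epsilon> < \<bar>v j - v i\<bar>" "\<bar>u j - u i\<bar> / r < \<bar>v j - v i\<bar>"
      using r \<epsilon> by (simp_all add: abs_minus_commute) (smt (verit) divide_nonneg_pos)+
    then have "pair i j" using r by (simp add: pair_def field_simps)
    then show False using that by (auto simp: Q_def U_def)
  qed
  show ?thesis
  proof (cases "Q = {}")
    case True
    have "(1/r)-lipschitz_on UNIV (\<lambda>_::real. 0::real)" using r by (intro lipschitz_onI) auto
    then show ?thesis using that UR(1) massU True unfolding Q_def by blast
  next
    case False
    have fQ: "finite Q" using R by (simp add: Q_def)
    \<comment> \<open>McShane extension of a Lipschitz inequality that holds only up to
      \<open>\<epsilon>\<close>: at \<open>u i\<close> the minimum lies between
      \<open>v i - \<epsilon>\<close> and \<open>v i\<close>, and the later shift by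
      \<open>\<epsilon> / 2\<close> centres this error.\<close>
    define F0 where "F0 s = Min ((\<lambda>i. v i + 1/r * \<bar>s - u i\<bar>) ` Q)" for s
    have F0le: "F0 s \<le> v i + 1/r * \<bar>s - u i\<bar>" if "i \<in> Q" for s i
      unfolding F0_def using fQ that by (intro Min_le) auto
    have F0ex: "\<exists>i\<in>Q. F0 s = v i + 1/r * \<bar>s - u i\<bar>" for s
    proof -
      have "F0 s \<in> (\<lambda>i. v i + 1/r * \<bar>s - u i\<bar>) ` Q"
        unfolding F0_def using fQ False by (intro Min_in) auto
      then show ?thesis by auto
    qed
    have lip1: "F0 s - F0 t \<le> 1/r * \<bar>s - t\<bar>" for s t
    proof -
      obtain i where i: "i \<in> Q" "F0 t = v i + 1/r * \<bar>t - u i\<bar>" using F0ex by blast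
      have "F0 s - F0 t \<le> 1/r * (\<bar>s - u i\<bar> - \<bar>t - u i\<bar>)" using F0le[OF i(1), of s] i(2) by (simp add: algebra_simps)
      also have "\<dots> \<le> 1/r * \<bar>s - t\<bar>" using r by (intro mult_left_mono) auto
      finally show ?thesis .
    qed
    define F where "F s = F0 s + \<epsilon> / 2" for s
    have "(1/r)-lipschitz_on UNIV F"
    proof (intro lipschitz_onI)
      fix s t :: real
      show "dist (F s) (F t) \<le> 1/r * dist s t"
        using lip1[of s t] lip1[of t s] by (auto simp: F_def dist_real_def abs_minus_commute)
    qed (use r in auto)
    moreover have "\<bar>v i - F (u i)\<bar> \<le> \<epsilon> / 2" if "i \<in> R - U" for i
    proof -
      have iQ: "i \<in> Q" using that by (simp add: Q_def)
      obtain j where j: "j \<in> Q" "F0 (u i) = v j + 1/r * \<bar>u i - u j\<bar>" using F0ex by blast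
      have "F0 (u i) \<le> v i" using F0le[OF iQ, of "u i"] by simp
      moreover have "v i - \<epsilon> \<le> F0 (u i)" using Q[OF iQ j(1)] j(2) by linarith
      ultimately show ?thesis unfolding F_def by linarith
    qed
    ultimately show ?thesis using that UR(1) massU by blast
  qed
qed

section \<open>Directions and dyadic arcs\<close>

text \<open>Angles are counted in full turns, so that dyadic intervals of \<open>[0, 1)\<close> are
  arcs. \<open>dir t\<close> is the normal of the lines considered, which therefore run along
  \<open>nrm t\<close>; "vertical" below means along \<open>nrm t\<close>.\<close>

definition dir :: "real \<Rightarrow> pt" where "dir t = vector [cos (2 * pi * t), sin (2 * pi * t)]"
definition nrm :: "real \<Rightarrow> pt" where "nrm t = vector [- sin (2 * pi * t), cos (2 * pi * t)]"

lemma inner_dir: "x \<bullet> dir t = x $ 1 * cos (2 * pi * t) + x $ 2 * sin (2 * pi * t)"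
  by (simp add: dir_def inner_vec_def sum_2)

lemma inner_nrm: "x \<bullet> nrm t = - x $ 1 * sin (2 * pi * t) + x $ 2 * cos (2 * pi * t)"
  by (simp add: nrm_def inner_vec_def sum_2)

lemma norm_dir [simp]: "norm (dir t) = 1" and norm_nrm [simp]: "norm (nrm t) = 1"
  by (simp_all add: dir_def nrm_def norm_vec_def L2_set_def sum_2)

lemma inner_dir_nrm [simp]: "dir t \<bullet> nrm t = 0"
  by (simp add: inner_nrm) (simp add: dir_def)

lemma dir_nrm_decomp: "x = (x \<bullet> dir t) *\<^sub>R dir t + (x \<bullet> nrm t) *\<^sub>R nrm t"
proof -
  define c s where "c = cos (2 * pi * t)" and "s = sin (2 * pi * t)"
  have cs: "c * c + s * s = 1" unfolding c_def s_def by (metis power2_eq_square sin_cos_squared_add3 add.commute)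
  have "x $ 1 = (x $ 1 * c + x $ 2 * s) * c + (- x $ 1 * s + x $ 2 * c) * (- s)"
       "x $ 2 = (x $ 1 * c + x $ 2 * s) * s + (- x $ 1 * s + x $ 2 * c) * c"
    using cs by algebra+
  then show ?thesis
    unfolding inner_dir inner_nrm unfolding dir_def nrm_def vec_eq_iff forall_2 c_def s_def by simp
qed

lemma norm_le_dir_nrm: "norm x \<le> \<bar>x \<bullet> dir t\<bar> + \<bar>x \<bullet> nrm t\<bar>"
  by (subst dir_nrm_decomp[of x t], rule order_trans[OF norm_triangle_ineq]) simp

lemma abs_inner_dir_le: "\<bar>x \<bullet> dir t\<bar> \<le> norm x" and abs_inner_nrm_le: "\<bar>x \<bullet> nrm t\<bar> \<le> norm x"
  using Cauchy_Schwarz_ineq2[of x "dir t"] Cauchy_Schwarz_ineq2[of x "nrm t"] by simp_all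

lemma norm_dir_diff_le: "norm (dir t - dir s) \<le> 2 * pi * \<bar>t - s\<bar>"
proof -
  have "(norm (dir t - dir s))\<^sup>2 = (cos (2 * pi * t) - cos (2 * pi * s))\<^sup>2 + (sin (2 * pi * t) - sin (2 * pi * s))\<^sup>2"
    by (simp add: dir_def norm_vec_def L2_set_def sum_2)
  also have "\<dots> = 2 - 2 * cos (2 * pi * t - 2 * pi * s)"
    using sin_cos_squared_add[of "2 * pi * t"] sin_cos_squared_add[of "2 * pi * s"]
    unfolding cos_diff by (simp add: power2_eq_square algebra_simps)
  also have "\<dots> = (2 * sin (pi * (t - s)))\<^sup>2"
    using cos_double_sin[of "pi * (t - s)"] by (simp add: algebra_simps power2_eq_square)
  also have "\<dots> \<le> (2 * (pi * (t - s)))\<^sup>2"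
    using abs_sin_x_le_abs_x[of "pi * (t - s)"] by (simp add: abs_le_square_iff[symmetric] abs_mult)
  also have "\<dots> = (2 * pi * \<bar>t - s\<bar>)\<^sup>2" by (simp add: power_mult_distrib)
  finally show ?thesis by (rule power2_le_imp_le) simp
qed

lemma inner_dir_close:
  assumes "x \<bullet> dir s = 0"
  shows "\<bar>x \<bullet> dir t\<bar> \<le> norm x * (2 * pi * \<bar>t - s\<bar>)"
proof -
  have "\<bar>x \<bullet> dir t\<bar> = \<bar>x \<bullet> (dir t - dir s)\<bar>" using assms by (simp add: inner_diff_right)
  also have "\<dots> \<le> norm x * norm (dir t - dir s)" by (rule Cauchy_Schwarz_ineq2)
  also have "\<dots> \<le> norm x * (2 * pi * \<bar>t - s\<bar>)" using norm_dir_diff_le by (intro mult_left_mono) auto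
  finally show ?thesis .
qed

text \<open>Turn the frame by the arctangent of the slope \<open>z\<close> of \<open>x\<close>
  against \<open>nrm t\<close>; the angle is at most the slope.\<close>

lemma exists_orthogonal_dir:
  assumes "\<bar>x \<bullet> dir t\<bar> \<le> s * \<bar>x \<bullet> nrm t\<bar>" and "x \<bullet> nrm t \<noteq> 0"
  obtains t' where "x \<bullet> dir t' = 0" "\<bar>t' - t\<bar> \<le> s / (2 * pi)"
proof -
  define z where "z = (x \<bullet> dir t) / (x \<bullet> nrm t)"
  define t' where "t' = t - arctan z / (2 * pi)"
  have eq: "2 * pi * t' = 2 * pi * t - arctan z" by (simp add: t'_def field_simps)
  have "x \<bullet> dir t' = (x \<bullet> dir t) * cos (arctan z) - (x \<bullet> nrm t) * sin (arctan z)"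
    unfolding inner_dir inner_nrm eq cos_diff sin_diff by (simp add: algebra_simps)
  also have "\<dots> = 0" using assms(2) by (simp add: cos_arctan sin_arctan z_def)
  finally have "x \<bullet> dir t' = 0" .
  moreover have "\<bar>t' - t\<bar> \<le> s / (2 * pi)"
  proof -
    have "\<bar>arctan z\<bar> \<le> \<bar>z\<bar>" by (rule abs_arctan_le)
    also have "\<dots> \<le> s" using assms by (simp add: z_def field_simps)
    finally show ?thesis by (simp add: t'_def divide_right_mono)
  qed
  ultimately show ?thesis by (rule that)
qed

text \<open>The arc of level \<open>b\<close> containing the leaf \<open>l\<close> of level
  \<open>\<Lambda>\<close> has index \<open>l div 2 ^ (\<Lambda> - b)\<close>, so passing to an
  ancestor is integer division.\<close>

definition cell :: "nat \<Rightarrow> nat \<Rightarrow> real set" where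
  "cell b j = {real j / 2 ^ b..<(real j + 1) / 2 ^ b}"

text \<open>A two-sided cone: \<open>v\<close> is parallel to some line whose normal lies in the
  arc, without regard to orientation.\<close>

definition sees :: "nat \<Rightarrow> nat \<Rightarrow> pt \<Rightarrow> bool" where
  "sees b j v \<longleftrightarrow> (\<exists>t\<in>cell b j. v \<bullet> dir t = 0)"

lemma cell_mono:
  assumes "b \<le> A"
  shows "cell A j \<subseteq> cell b (j div 2 ^ (A - b))"
proof
  fix t assume t: "t \<in> cell A j"
  define m where "m = (2::nat) ^ (A - b)"
  have m: "0 < m" "(2::real) ^ A = 2 ^ b * real m" using assms by (auto simp: m_def simp flip: power_add)
  have "j div m * m \<le> j" "j + 1 \<le> (j div m + 1) * m"
    using m dividend_less_div_times[of m j] by (auto simp: algebra_simps)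
  then have "real (j div m * m) \<le> real j" "real (j + 1) \<le> real ((j div m + 1) * m)" by (auto simp only: of_nat_le_iff)
  then have "real (j div m) * m \<le> j" "real j + 1 \<le> (real (j div m) + 1) * m" by (auto simp: algebra_simps)
  moreover have "real j / 2 ^ A \<le> t" "t < (real j + 1) / 2 ^ A" using t by (auto simp: cell_def)
  ultimately have "real (j div m) * m / 2 ^ A \<le> t" "t < (real (j div m) + 1) * m / 2 ^ A"
    by (meson divide_right_mono order_trans zero_le_numeral zero_le_power order_less_le_trans)+
  then show "t \<in> cell b (j div 2 ^ (A - b))" using m unfolding cell_def m_def by simp
qed

lemma cell_div_mono:
  assumes "b \<le> A" "A \<le> \<Lambda>"
  shows "cell A (l div 2 ^ (\<Lambda> - A)) \<subseteq> cell b (l div 2 ^ (\<Lambda> - b))"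
proof -
  have "(2::nat) ^ (\<Lambda> - b) = 2 ^ (\<Lambda> - A) * 2 ^ (A - b)" using assms by (simp flip: power_add)
  then show ?thesis using cell_mono[OF assms(1), of "l div 2 ^ (\<Lambda> - A)"] by (simp add: div_mult2_eq)
qed

lemma cell_split: "cell b j = cell (Suc b) (2 * j) \<union> cell (Suc b) (2 * j + 1)"
proof -
  have "real (2 * j) / 2 ^ Suc b = real j / 2 ^ b" "(real (2 * j + 1) + 1) / 2 ^ Suc b = (real j + 1) / 2 ^ b"
    "(real (2 * j) + 1) / 2 ^ Suc b = real (2 * j + 1) / 2 ^ Suc b"
    by (simp_all add: field_simps)
  then show ?thesis unfolding cell_def
    by (auto simp: field_simps)
qed

lemma cell_diam:
  assumes "s \<in> cell b j" "t \<in> cell b j"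
  shows "\<bar>s - t\<bar> \<le> 1 / 2 ^ b"
  using assms by (auto simp: cell_def add_divide_distrib abs_le_iff)

section \<open>Projections, contents and Favard length\<close>

lemma emeasure_UN_Icc_le:
  fixes u r :: "'a \<Rightarrow> real"
  assumes "finite V" and "\<And>i. i \<in> V \<Longrightarrow> 0 \<le> r i"
  shows "emeasure lborel (\<Union>i\<in>V. {u i - r i..u i + r i}) \<le> ennreal (2 * sum r V)"
proof -
  have "emeasure lborel (\<Union>i\<in>V. {u i - r i..u i + r i}) \<le> (\<Sum>i\<in>V. emeasure lborel {u i - r i..u i + r i})"
    using assms(1) by (intro emeasure_subadditive_finite) auto
  also have "\<dots> = (\<Sum>i\<in>V. ennreal (2 * r i))" using assms(2) by (intro sum.cong) auto
  also have "\<dots> = ennreal (2 * sum r V)" using assms(2) by (subst sum_ennreal) (auto simp: sum_distrib_left)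
  finally show ?thesis .
qed

text \<open>A real \<open>Sup\<close> says something only about a set bounded above; here every
  quotient is at most 1. \<open>Z\<close> is a coordinate projection of a compact set, since
  \<open>F\<close> is continuous, and is therefore measurable.\<close>

lemma rect_const_graph:
  fixes E :: "pt set" and F :: "real \<Rightarrow> real" and \<epsilon> c d r M :: real and \<omega>1 \<omega>2 :: pt
  assumes "compact E" "0 < r" "M-lipschitz_on UNIV F" "norm \<omega>1 = 1" "norm \<omega>2 = 1" "\<omega>1 \<bullet> \<omega>2 = 0" "r \<le> d - c"
  defines "Z \<equiv> {x \<in> {c..d}. \<exists>y. -\<epsilon> \<le> y \<and> y \<le> \<epsilon> \<and> x *\<^sub>R \<omega>1 + (F x + y) *\<^sub>R \<omega>2 \<in> E}"
  shows "Z \<in> sets borel" "emeasure lborel Z \<le> ennreal (rect_const E \<epsilon> r M * (d - c))"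
proof -
  have comp: "compact {x \<in> {c..d}. \<exists>y. -\<epsilon> \<le> y \<and> y \<le> \<epsilon> \<and> x *\<^sub>R \<omega>1 + (F x + y) *\<^sub>R \<omega>2 \<in> E}"
    if "continuous_on UNIV F" for F \<omega>1 \<omega>2 and c d :: real
  proof -
    let ?\<phi> = "\<lambda>p. fst p *\<^sub>R \<omega>1 + (F (fst p) + snd p) *\<^sub>R \<omega>2"
    have "continuous_on UNIV ?\<phi>"
      by (intro continuous_intros continuous_on_compose2[OF that]) auto
    then have "closed (?\<phi> -` E)" using assms(1) by (intro closed_vimage) (auto simp: compact_imp_closed)
    then have "compact (({c..d} \<times> {-\<epsilon>..\<epsilon>}) \<inter> ?\<phi> -` E)" by (intro compact_Int_closed compact_Times) auto
    then have "compact (fst ` (({c..d} \<times> {-\<epsilon>..\<epsilon>}) \<inter> ?\<phi> -` E))" by (intro compact_continuous_image continuous_intros) auto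
    moreover have "fst ` (({c..d} \<times> {-\<epsilon>..\<epsilon>}) \<inter> ?\<phi> -` E) =
      {x \<in> {c..d}. \<exists>y. -\<epsilon> \<le> y \<and> y \<le> \<epsilon> \<and> x *\<^sub>R \<omega>1 + (F x + y) *\<^sub>R \<omega>2 \<in> E}" by force
    ultimately show ?thesis by simp
  qed
  have cZ: "compact Z" unfolding Z_def using comp lipschitz_on_continuous_on[OF assms(3)] by blast
  then show "Z \<in> sets borel" by (intro borel_compact)
  let ?X = "{measure lborel {x \<in> {a..b}. \<exists>y. -\<epsilon> \<le> y \<and> y \<le> \<epsilon> \<and>
          x *\<^sub>R \<omega>1 + (F x + y) *\<^sub>R \<omega>2 \<in> E} / (b - a) | \<omega>1 \<omega>2 F a b.
      norm \<omega>1 = 1 \<and> norm \<omega>2 = 1 \<and> \<omega>1 \<bullet> \<omega>2 = 0 \<and> M-lipschitz_on UNIV F \<and> b - a \<ge> r}"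
  have "s \<le> 1" if sX: "s \<in> ?X" for s
  proof -
    obtain \<omega>1 \<omega>2 F a b where s: "s = measure lborel {x \<in> {a..b}. \<exists>y. -\<epsilon> \<le> y \<and> y \<le> \<epsilon> \<and>
          x *\<^sub>R \<omega>1 + (F x + y) *\<^sub>R \<omega>2 \<in> E} / (b - a)" and "M-lipschitz_on UNIV F" "b - a \<ge> r"
      using sX by blast
    have "measure lborel {x \<in> {a..b}. \<exists>y. -\<epsilon> \<le> y \<and> y \<le> \<epsilon> \<and> x *\<^sub>R \<omega>1 + (F x + y) *\<^sub>R \<omega>2 \<in> E} \<le> measure lborel {a..b}"
      using comp[OF lipschitz_on_continuous_on[OF \<open>M-lipschitz_on UNIV F\<close>]]
      by (intro measure_mono_fmeasurable)
        (auto simp: fmeasurable_def emeasure_lborel_Icc_eq intro!: borel_compact)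
    then show ?thesis using s \<open>b - a \<ge> r\<close> assms(2) by simp
  qed
  then have "bdd_above ?X" by (rule bdd_aboveI)
  moreover have "measure lborel Z / (d - c) \<in> ?X" unfolding Z_def using assms by blast
  ultimately have "measure lborel Z / (d - c) \<le> rect_const E \<epsilon> r M"
    unfolding rect_const_def by (intro cSup_upper)
  then have "measure lborel Z \<le> rect_const E \<epsilon> r M * (d - c)" using assms by (simp add: field_simps)
  moreover have "emeasure lborel Z = ennreal (measure lborel Z)"
    using emeasure_compact_finite[OF cZ] by (intro emeasure_eq_ennreal_measure) (auto simp: top.not_eq_extremum)
  ultimately show "emeasure lborel Z \<le> ennreal (rect_const E \<epsilon> r M * (d - c))" by (simp add: ennreal_leI)
qed

text \<open>By Fubini the Favard length is the mean over directions of the measure of the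
  projection, and each leaf carries mass \<open>1 / 2 ^ \<Lambda>\<close> of the circle. The
  incidence set \<open>W\<close> is closed because \<open>E\<close> is compact, which gives
  measurability.\<close>

lemma favard_le:
  assumes E: "compact E" and B: "\<And>l. l < 2 ^ \<Lambda> \<Longrightarrow> 0 \<le> B l"
    and le: "\<And>l t. l < 2 ^ \<Lambda> \<Longrightarrow> t \<in> cell \<Lambda> l \<Longrightarrow> emeasure lborel ((\<lambda>z. z \<bullet> dir t) ` E) \<le> ennreal (B l)"
  shows "favard E \<le> ennreal ((\<Sum>l<2 ^ \<Lambda>. B l) / 2 ^ \<Lambda>)"
proof -
  define W where "W = {(c, \<omega>). \<exists>x\<in>E. x \<bullet> \<omega> = c}"
  let ?e = "\<lambda>\<theta>::real. vector [cos \<theta>, sin \<theta>] :: pt"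
  let ?u = "uniform_measure lborel {0..<2 * pi}"
  have edir: "?e \<theta> = dir (\<theta> / (2 * pi))" for \<theta> by (simp add: dir_def)
  have e_cont: "continuous_on UNIV ?e"
  proof -
    have eq: "?e = (\<lambda>\<theta>::real. \<chi> i. if i = 1 then cos \<theta> else sin \<theta>)" by (auto simp: vec_eq_iff forall_2 fun_eq_iff)
    have cont: "continuous_on UNIV (\<lambda>\<theta>::real. (\<chi> i. if i = 1 then cos \<theta> else sin \<theta>) :: pt)"
    proof (intro continuous_on_vec_lambda)
      fix i :: 2 show "continuous_on UNIV (\<lambda>\<theta>::real. if i = 1 then cos \<theta> else sin \<theta>)"
        using continuous_on_cos[OF continuous_on_id, of "UNIV :: real set"]
          continuous_on_sin[OF continuous_on_id, of "UNIV :: real set"] by (cases "i = 1") simp_all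
    qed
    show ?thesis unfolding eq by (rule cont)
  qed
  have e_meas: "?e \<in> measurable borel borel" using e_cont by (rule borel_measurable_continuous_onI)
  have eu: "?e \<in> measurable ?u borel" using e_meas by simp
  interpret \<sigma>: finite_measure sigma_S1
  proof (rule finite_measureI)
    have "emeasure sigma_S1 (space sigma_S1) = emeasure ?u UNIV"
      unfolding sigma_S1_def using eu by (simp add: emeasure_distr)
    also have "\<dots> = emeasure lborel {0..<2 * pi} / emeasure lborel {0..<2 * pi}"
      by (subst emeasure_uniform_measure) auto
    also have "\<dots> = 1" by (simp add: divide_ennreal)
    finally show "emeasure sigma_S1 (space sigma_S1) \<noteq> \<infinity>" by simp
  qed
  interpret pair_sigma_finite lborel sigma_S1 ..
  have "closed W"
  proof -
    have "p \<in> W" if z: "\<forall>k. z k \<in> W" "z \<longlonglongrightarrow> p" for z p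
    proof -
      have "\<forall>k. \<exists>x. x \<in> E \<and> x \<bullet> snd (z k) = fst (z k)" using z(1) by (auto simp: W_def case_prod_beta)
      then obtain y where y: "\<And>k. y k \<in> E" "\<And>k. y k \<bullet> snd (z k) = fst (z k)" by metis
      obtain x r where x: "x \<in> E" "strict_mono (r :: nat \<Rightarrow> nat)" "(y \<circ> r) \<longlonglongrightarrow> x"
        using E y(1) unfolding compact_def by metis
      have zr: "(\<lambda>k. z (r k)) \<longlonglongrightarrow> p" using LIMSEQ_subseq_LIMSEQ[OF z(2) x(2)] by (simp add: o_def)
      have "(\<lambda>k. y (r k) \<bullet> snd (z (r k))) \<longlonglongrightarrow> x \<bullet> snd p"
        using x(3) zr by (intro tendsto_intros) (auto simp: o_def)
      then have "(\<lambda>k. fst (z (r k))) \<longlonglongrightarrow> x \<bullet> snd p" by (simp add: y(2))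
      moreover have "(\<lambda>k. fst (z (r k))) \<longlonglongrightarrow> fst p" by (intro tendsto_intros zr)
      ultimately have "x \<bullet> snd p = fst p" by (rule LIMSEQ_unique)
      then show ?thesis using x(1) by (auto simp: W_def case_prod_beta)
    qed
    then show ?thesis unfolding closed_sequential_limits by blast
  qed
  then have "W \<in> sets borel" by (rule borel_closed)
  then have "W \<in> sets (borel \<Otimes>\<^sub>M borel)" by (simp only: borel_prod)
  also have "sets (borel \<Otimes>\<^sub>M borel) = sets (lborel \<Otimes>\<^sub>M sigma_S1)" by (intro sets_pair_measure_cong) (auto simp: sigma_S1_def)
  finally have W: "W \<in> sets (lborel \<Otimes>\<^sub>M sigma_S1)" .
  define f where "f \<omega> = emeasure lborel ((\<lambda>c. (c, \<omega>)) -` W)" for \<omega>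
  have f_meas: "f \<in> borel_measurable borel"
    using measurable_emeasure_Pair2[OF W] unfolding f_def by (simp add: sigma_S1_def measurable_def)
  have slice: "(\<lambda>c. (c, \<omega>)) -` W = (\<lambda>z. z \<bullet> \<omega>) ` E" for \<omega> by (auto simp: W_def)
  have "favard E = (\<integral>\<^sup>+\<omega>. f \<omega> \<partial>sigma_S1)"
    unfolding favard_def W_def[symmetric] f_def by (rule emeasure_pair_measure_alt2[OF W])
  also have "\<dots> = (\<integral>\<^sup>+\<theta>. f (?e \<theta>) \<partial>?u)"
    unfolding sigma_S1_def using eu f_meas by (intro nn_integral_distr) auto
  also have "\<dots> = (\<integral>\<^sup>+\<theta>. f (?e \<theta>) * indicator {0..<2 * pi} \<theta> \<partial>lborel) / emeasure lborel {0..<2 * pi}"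
    using measurable_compose[OF e_meas f_meas] by (intro nn_integral_uniform_measure) auto
  also have "\<dots> = (\<integral>\<^sup>+\<theta>. f (?e \<theta>) * indicator {0..<2 * pi} \<theta> \<partial>lborel) / ennreal (2 * pi)" by simp
  also have "\<dots> \<le> ennreal (\<Sum>l<2 ^ \<Lambda>. B l * (2 * pi / 2 ^ \<Lambda>)) / ennreal (2 * pi)"
  proof (intro divide_right_mono_ennreal)
    define J where "J l = {2 * pi * (real l / 2 ^ \<Lambda>)..<2 * pi * ((real l + 1) / 2 ^ \<Lambda>)}" for l
    have "(\<integral>\<^sup>+\<theta>. f (?e \<theta>) * indicator {0..<2 * pi} \<theta> \<partial>lborel) \<le> (\<integral>\<^sup>+\<theta>. (\<Sum>l<2 ^ \<Lambda>. ennreal (B l) * indicator (J l) \<theta>) \<partial>lborel)"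
    proof (intro nn_integral_mono)
      fix \<theta> :: real
      show "f (?e \<theta>) * indicator {0..<2 * pi} \<theta> \<le> (\<Sum>l<2 ^ \<Lambda>. ennreal (B l) * indicator (J l) \<theta>)"
      proof (cases "\<theta> \<in> {0..<2 * pi}")
        case True
        define t where "t = \<theta> / (2 * pi)"
        have t: "0 \<le> t" "t < 1" using True by (auto simp: t_def)
        define l where "l = nat \<lfloor>t * 2 ^ \<Lambda>\<rfloor>"
        have lf: "real l \<le> t * 2 ^ \<Lambda>" "t * 2 ^ \<Lambda> < real l + 1" using t by (auto simp: l_def)
        have "t * 2 ^ \<Lambda> < 2 ^ \<Lambda>" using t by simp
        with lf(1) have "real l < 2 ^ \<Lambda>" by (rule order_le_less_trans)
        then have "real l < real (2 ^ \<Lambda>)" by simp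
        then have l: "l < 2 ^ \<Lambda>" by (simp only: of_nat_less_iff)
        have tl: "real l / 2 ^ \<Lambda> \<le> t" "t < (real l + 1) / 2 ^ \<Lambda>" using lf by (auto simp: field_simps)
        then have tc: "t \<in> cell \<Lambda> l" by (simp add: cell_def)
        have \<theta>: "\<theta> = 2 * pi * t" by (simp add: t_def)
        have "2 * pi * (real l / 2 ^ \<Lambda>) \<le> 2 * pi * t" using tl(1) by (intro mult_left_mono) auto
        moreover have "2 * pi * t < 2 * pi * ((real l + 1) / 2 ^ \<Lambda>)" using tl(2) by (intro mult_strict_left_mono) auto
        ultimately have "\<theta> \<in> J l" unfolding J_def \<theta> atLeastLessThan_iff by blast
        have "f (?e \<theta>) \<le> ennreal (B l)" unfolding f_def slice edir using le[OF l tc] by (simp add: t_def)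
        also have "\<dots> = ennreal (B l) * indicator (J l) \<theta>" using \<open>\<theta> \<in> J l\<close> by simp
        also have "\<dots> \<le> (\<Sum>l<2 ^ \<Lambda>. ennreal (B l) * indicator (J l) \<theta>)"
          using l by (intro member_le_sum) auto
        finally show ?thesis using True by simp
      qed simp
    qed
    also have "\<dots> = (\<Sum>l<2 ^ \<Lambda>. \<integral>\<^sup>+\<theta>. ennreal (B l) * indicator (J l) \<theta> \<partial>lborel)"
      by (rule nn_integral_sum) (simp add: J_def)
    also have "\<dots> = (\<Sum>l<2 ^ \<Lambda>. ennreal (B l) * emeasure lborel (J l))"
      by (intro sum.cong refl nn_integral_cmult_indicator) (simp add: J_def)
    also have "\<dots> = (\<Sum>l<2 ^ \<Lambda>. ennreal (B l * (2 * pi / 2 ^ \<Lambda>)))"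
    proof (intro sum.cong refl)
      fix l :: nat assume "l \<in> {..<2 ^ \<Lambda>}"
      have "2 * pi * (real l / 2 ^ \<Lambda>) \<le> 2 * pi * ((real l + 1) / 2 ^ \<Lambda>)" by (intro mult_left_mono divide_right_mono) auto
      then have "emeasure lborel (J l) = ennreal (2 * pi / 2 ^ \<Lambda>)"
        unfolding J_def by (simp add: field_simps)
      moreover have "ennreal (B l * (2 * pi / 2 ^ \<Lambda>)) = ennreal (B l) * ennreal (2 * pi / 2 ^ \<Lambda>)"
        using B[of l] \<open>l \<in> _\<close> by (intro ennreal_mult) auto
      ultimately show "ennreal (B l) * emeasure lborel (J l) = ennreal (B l * (2 * pi / 2 ^ \<Lambda>))"
        by (simp only:)
    qed
    also have "\<dots> = ennreal (\<Sum>l<2 ^ \<Lambda>. B l * (2 * pi / 2 ^ \<Lambda>))" using B by (intro sum_ennreal) auto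
    finally show "(\<integral>\<^sup>+\<theta>. f (?e \<theta>) * indicator {0..<2 * pi} \<theta> \<partial>lborel) \<le> ennreal (\<Sum>l<2 ^ \<Lambda>. B l * (2 * pi / 2 ^ \<Lambda>))" .
  qed
  also have "\<dots> = ennreal ((\<Sum>l<2 ^ \<Lambda>. B l * (2 * pi / 2 ^ \<Lambda>)) / (2 * pi))"
    using B by (intro divide_ennreal sum_nonneg) auto
  also have "(\<Sum>l<2 ^ \<Lambda>. B l * (2 * pi / 2 ^ \<Lambda>)) / (2 * pi) = (\<Sum>l<2 ^ \<Lambda>. B l) / 2 ^ \<Lambda>"
    by (simp add: sum_divide_distrib[symmetric] sum_distrib_right[symmetric])
  finally show ?thesis .
qed

text \<open>The infimum need not be attained, so a cover of total diameter below
  \<open>2 * L\<close> is taken; as a diameter is twice a radius, the radii still sum to at most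
  \<open>L\<close>. Compactness makes the cover finite, and balls missing \<open>E\<close> are
  dropped so that each can be recentred in \<open>E\<close>.\<close>

lemma finite_cover_of_content:
  assumes E: "compact E" and L: "0 < L" and le: "sph_content r r' E \<le> ennreal L" and r: "0 \<le> r"
  obtains B where "finite B" "\<And>b. b \<in> B \<Longrightarrow> r \<le> snd b \<and> snd b \<le> r'" "E \<subseteq> (\<Union>b\<in>B. ball (fst b) (snd b))"
    "sum snd B \<le> L" "\<And>b. b \<in> B \<Longrightarrow> \<exists>x\<in>E. x \<in> ball (fst b) (snd b)"
proof -
  have "sph_content r r' E < ennreal (2 * L)" 
    using L by (intro order_le_less_trans[OF le]) (simp add: ennreal_less_iff)
  then obtain B0 where B0: "(\<integral>\<^sup>+ b. ennreal (diameter (ball (fst b) (snd b))) \<partial>count_space B0) < ennreal (2 * L)"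
      "\<forall>b\<in>B0. r \<le> snd b \<and> snd b \<le> r'" "E \<subseteq> (\<Union>b\<in>B0. ball (fst b) (snd b))"
    unfolding sph_content_def Inf_less_iff by blast
  obtain B1 where B1: "B1 \<subseteq> B0" "finite B1" "E \<subseteq> (\<Union>b\<in>B1. ball (fst b) (snd b))"
    by (rule compactE_image[OF E _ B0(3)]) auto
  define B where "B = {b\<in>B1. \<exists>x\<in>E. x \<in> ball (fst b) (snd b)}"
  have B: "finite B" "B \<subseteq> B0" using B1 by (auto simp: B_def)
  have rad: "r \<le> snd b \<and> snd b \<le> r'" if "b \<in> B" for b using that B B0(2) by auto
  have "ennreal (2 * sum snd B) = (\<Sum>b\<in>B. ennreal (diameter (ball (fst b) (snd b))))"
  proof -
    have "(\<Sum>b\<in>B. ennreal (diameter (ball (fst b) (snd b)))) = (\<Sum>b\<in>B. ennreal (2 * snd b))"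
      using rad r by (intro sum.cong refl) (force simp: diameter_ball)
    also have "\<dots> = ennreal (\<Sum>b\<in>B. 2 * snd b)" using rad r by (intro sum_ennreal) force
    finally show ?thesis by (simp add: sum_distrib_left)
  qed
  also have "\<dots> = (\<integral>\<^sup>+ b. ennreal (diameter (ball (fst b) (snd b))) * indicator B b \<partial>count_space B0)"
    using B by (subst nn_integral_count_space'[of B]) (auto intro!: sum.cong)
  also have "\<dots> \<le> (\<integral>\<^sup>+ b. ennreal (diameter (ball (fst b) (snd b))) \<partial>count_space B0)"
    by (intro nn_integral_mono) (auto simp: indicator_def)
  finally have "ennreal (2 * sum snd B) < ennreal (2 * L)" using B0(1) by (rule order_le_less_trans)
  then have "sum snd B \<le> L" 
    using L by (metis ennreal_leI linorder_not_less mult_le_cancel_left_pos nle_le zero_less_numeral)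
  moreover have "E \<subseteq> (\<Union>b\<in>B. ball (fst b) (snd b))"
  proof
    fix x assume x: "x \<in> E"
    then obtain b where "b \<in> B1" "x \<in> ball (fst b) (snd b)" using B1(3) by blast
    then show "x \<in> (\<Union>b\<in>B. ball (fst b) (snd b))" using x unfolding B_def by blast
  qed
  ultimately show ?thesis using that[of B] B(1) rad unfolding B_def by auto
qed

lemma sph_content_le_measure:
  assumes "0 < r"
  shows "sph_content 0 r E \<le> sph_measure E"
proof -
  let ?f = "\<lambda>r. sph_content 0 r E"
  have anti: "?f s' \<le> ?f s" if "s \<le> s'" for s s'
    unfolding sph_content_def by (rule Inf_superset_mono) (use that in force)
  define M where "M = (SUP r\<in>{0<..}. ?f r)"
  have upper: "?f s \<le> M" if "0 < s" for s unfolding M_def using that by (intro SUP_upper) auto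
  have "(?f \<longlongrightarrow> M) (at_right 0)"
  proof (rule order_tendstoI)
    fix y assume "y < M"
    then obtain s where s: "0 < s" "y < ?f s" unfolding M_def less_SUP_iff by auto
    then have "y < ?f s'" if "0 < s'" "s' < s" for s' using anti[of s' s] that by (meson less_imp_le order_less_le_trans)
    then show "eventually (\<lambda>s. y < ?f s) (at_right 0)"
      unfolding eventually_at_right_field using s(1) by blast
  next
    fix y assume "M < y"
    then have "?f s < y" if "0 < s" for s using upper[OF that] by (rule order_le_less_trans[rotated])
    then show "eventually (\<lambda>s. ?f s < y) (at_right 0)"
      unfolding eventually_at_right_field by (intro exI[of _ 1]) auto
  qed
  then have "sph_measure E = M" unfolding sph_measure_def by (intro tendsto_Lim) auto
  then show ?thesis using upper[OF assms] by simp
qed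

text \<open>A ball casts a shadow of twice its radius in every direction. This crude bound serves
  when \<open>N\<close> is too small for the multiscale argument.\<close>

lemma favard_le_content:
  assumes E: "compact E" and L: "0 < L" and le: "sph_content r r' E \<le> ennreal L" and r: "0 \<le> r"
  shows "favard E \<le> ennreal (2 * L)"
proof -
  obtain B where B: "finite B" "\<And>b. b \<in> B \<Longrightarrow> r \<le> snd b \<and> snd b \<le> r'" "E \<subseteq> (\<Union>b\<in>B. ball (fst b) (snd b))"
    "sum snd B \<le> L" by (rule finite_cover_of_content[OF E L le r]) blast
  have "favard E \<le> ennreal ((\<Sum>l<(2::nat) ^ 0. 2 * L) / 2 ^ 0)"
  proof (rule favard_le[OF E])
    fix t
    have "(\<lambda>z. z \<bullet> dir t) ` E \<subseteq> (\<Union>b\<in>B. {fst b \<bullet> dir t - snd b..fst b \<bullet> dir t + snd b})"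
    proof
      fix c assume "c \<in> (\<lambda>z. z \<bullet> dir t) ` E"
      then obtain z where z: "z \<in> E" "c = z \<bullet> dir t" by auto
      obtain b where b: "b \<in> B" "z \<in> ball (fst b) (snd b)" using B(3) z by blast
      have "\<bar>c - fst b \<bullet> dir t\<bar> \<le> snd b"
        using abs_inner_dir_le[of "z - fst b" t] b z by (simp add: dist_norm norm_minus_commute inner_diff_left)
      then show "c \<in> (\<Union>b\<in>B. {fst b \<bullet> dir t - snd b..fst b \<bullet> dir t + snd b})" using b by (intro UN_I[of b]) auto
    qed
    then have "emeasure lborel ((\<lambda>z. z \<bullet> dir t) ` E) \<le> emeasure lborel (\<Union>b\<in>B. {fst b \<bullet> dir t - snd b..fst b \<bullet> dir t + snd b})"
      using B(1) by (intro emeasure_mono) (auto intro!: sets.finite_UN)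
    also have "\<dots> \<le> ennreal (2 * sum snd B)" using B r by (intro emeasure_UN_Icc_le) force+
    also have "\<dots> \<le> ennreal (2 * L)" using B(4) by (intro ennreal_leI) auto
    finally show "emeasure lborel ((\<lambda>z. z \<bullet> dir t) ` E) \<le> ennreal (2 * L)" .
  qed (use L in auto)
  then show ?thesis by simp
qed

section \<open>The multiscale argument\<close>

text \<open>
  The points \<open>P i\<close> with weights \<open>w i\<close> discretise \<open>E\<close> at a scale \<open>rs\<close> far below \<open>rm N\<close>. Dyadic arcs of directions at scale \<open>n\<close>
  have level \<open>a n\<close>; all of them are unions of arcs of the finest level \<open>\<Lambda>\<close>, and \<open>l\<close> always denotes an arc of that level.
  The range \<open>n0..N - g\<close> keeps the scales small compared with \<open>1 / q\<close> and leaves room for the resolution \<open>n + g\<close>.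
\<close>

locale multiscale =
  fixes E :: "pt set" and L q \<eta> rs :: real and n0 N g \<Lambda> \<beta> :: nat and rm rp :: "nat \<Rightarrow> real"
    and a :: "nat \<Rightarrow> nat" and cov :: "nat \<Rightarrow> (pt \<times> real) set"
    and S :: "'i set" and P :: "'i \<Rightarrow> pt" and w :: "'i \<Rightarrow> real"
  assumes compact_E: "compact E" and L: "0 < L" and q: "4000 \<le> q" and \<eta>_def: "\<eta> = 1 / q ^ 4"
    and rm_pos: "\<And>n. n0 \<le> n \<Longrightarrow> n \<le> N \<Longrightarrow> 0 < rm n"
    and rm_le_rp: "\<And>n. n0 \<le> n \<Longrightarrow> n \<le> N \<Longrightarrow> rm n \<le> rp n"
    and rp_small: "\<And>n. n0 \<le> n \<Longrightarrow> n \<le> N \<Longrightarrow> 120 * q * rp n \<le> 1"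
    and rp_step: "\<And>n. n0 \<le> n \<Longrightarrow> n < N \<Longrightarrow> rp (Suc n) \<le> rm n / 2"
    and rect: "\<And>n. n0 \<le> n \<Longrightarrow> n < N \<Longrightarrow> rect_const E (rp (Suc n)) (rm n) (1 / rm n) \<le> 1 / q"
    and cov_fin: "\<And>n. n0 \<le> n \<Longrightarrow> n \<le> N \<Longrightarrow> finite (cov n)"
    and cov_rad: "\<And>n b. n0 \<le> n \<Longrightarrow> n \<le> N \<Longrightarrow> b \<in> cov n \<Longrightarrow> rm n \<le> snd b \<and> snd b \<le> rp n"
    and cov_cover: "\<And>n. n0 \<le> n \<Longrightarrow> n \<le> N \<Longrightarrow> E \<subseteq> (\<Union>b\<in>cov n. ball (fst b) (snd b))"
    and cov_sum: "\<And>n. n0 \<le> n \<Longrightarrow> n \<le> N \<Longrightarrow> sum snd (cov n) \<le> L"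
    and S_fin: "finite S" and P_in: "\<And>i. i \<in> S \<Longrightarrow> P i \<in> E" and w_nonneg: "\<And>i. i \<in> S \<Longrightarrow> 0 \<le> w i"
    and w_le: "\<And>i. i \<in> S \<Longrightarrow> w i \<le> rs" and S_cover: "E \<subseteq> (\<Union>i\<in>S. cball (P i) (w i))"
    and w_sum: "sum w S \<le> 2 * L"
    and rs: "0 < rs" "rs \<le> (rm N)\<^sup>2 / 4"
    and a_ge: "\<And>n. n0 \<le> n \<Longrightarrow> n \<le> N \<Longrightarrow> 2 * q * rm n \<le> 1 / 2 ^ a n"
    and a_le: "\<And>n. n0 \<le> n \<Longrightarrow> n \<le> N \<Longrightarrow> 1 / 2 ^ a n \<le> 4 * q * rm n"
    and a_mono: "\<And>m n. n0 \<le> m \<Longrightarrow> m \<le> n \<Longrightarrow> n \<le> N \<Longrightarrow> a m \<le> a n"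
    and a_bound: "\<And>n. n0 \<le> n \<Longrightarrow> n \<le> N \<Longrightarrow> a n + \<beta> \<le> \<Lambda>"
    and \<beta>: "q \<le> 2 ^ \<beta>" "2 ^ \<beta> \<le> 2 * q"
    and g: "5 \<le> g" and n0: "1 \<le> n0" "n0 + g \<le> N"
    and many: "10 * N * q ^ 6 \<le> card {n0..N - g} * (real g - 4)" "8 * g * q ^ 11 \<le> card {n0..N - g}"
begin

section \<open>Decay of the scales\<close>

lemma rp_pos: "n0 \<le> n \<Longrightarrow> n \<le> N \<Longrightarrow> 0 < rp n"
  using rm_pos rm_le_rp by (meson less_le_trans)

lemma rp_decay: "n0 \<le> m \<Longrightarrow> m + d \<le> N \<Longrightarrow> rp (m + d) * 2 ^ d \<le> rp m"
proof (induction d)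
  case (Suc d)
  have "rp (m + Suc d) \<le> rm (m + d) / 2" using rp_step[of "m + d"] Suc by simp
  also have "\<dots> \<le> rp (m + d) / 2" using rm_le_rp[of "m + d"] Suc by simp
  finally have "rp (m + Suc d) * 2 \<le> rp (m + d)" by simp
  then have "rp (m + Suc d) * 2 * 2 ^ d \<le> rp (m + d) * 2 ^ d" by (intro mult_right_mono) auto
  also have "\<dots> \<le> rp m" using Suc by simp
  finally show ?case by simp
qed simp

lemma rp_antimono: "n0 \<le> m \<Longrightarrow> m \<le> n \<Longrightarrow> n \<le> N \<Longrightarrow> rp n \<le> rp m"
proof -
  assume "n0 \<le> m" "m \<le> n" "n \<le> N"
  then have "rp n * 2 ^ (n - m) \<le> rp m" using rp_decay[of m "n - m"] by simp
  moreover have "rp n * 1 \<le> rp n * 2 ^ (n - m)"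
    using rp_pos[of n] \<open>n0 \<le> m\<close> \<open>m \<le> n\<close> \<open>n \<le> N\<close> by (intro mult_left_mono) auto
  ultimately show ?thesis by simp
qed

lemma rmN_le_rm: "n0 \<le> n \<Longrightarrow> n \<le> N \<Longrightarrow> rm N \<le> rm n"
proof (cases "n = N")
  case False
  assume n: "n0 \<le> n" "n \<le> N"
  have "rm N \<le> rp N" using rm_le_rp n by auto
  also have "\<dots> \<le> rp (Suc n)" using rp_antimono[of "Suc n" N] n False by auto
  also have "\<dots> \<le> rm n" using rp_step[of n] rm_pos[of n] n False by auto
  finally show ?thesis .
qed simp

lemma rm_small: "n0 \<le> n \<Longrightarrow> n \<le> N \<Longrightarrow> 120 * q * rm n \<le> 1"
proof -
  assume n: "n0 \<le> n" "n \<le> N"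
  have "120 * q * rm n \<le> 120 * q * rp n" using rm_le_rp[OF n] q by (intro mult_left_mono) auto
  then show ?thesis using rp_small[OF n] by simp
qed

lemma rm_le_1: "n0 \<le> n \<Longrightarrow> n \<le> N \<Longrightarrow> rm n \<le> 1/100"
proof -
  assume n: "n0 \<le> n" "n \<le> N"
  have "120 * 1 * rm n \<le> 120 * q * rm n" using rm_pos[OF n] q by (intro mult_right_mono) auto
  then show ?thesis using rm_small[OF n] by simp
qed

lemma rs_le_rmN: "rs \<le> rm N"
proof -
  have "rm N * rm N \<le> rm N * 1" using rm_pos[of N] rm_le_1[of N] n0 by (intro mult_left_mono) auto
  moreover have "0 < rm N" using rm_pos[of N] n0 by simp
  ultimately show ?thesis using rs unfolding power2_eq_square by linarith
qed

section \<open>Bad directions and the weight of cones\<close>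

text \<open>The inner limit is half the tolerance \<open>rp (Suc n)\<close> of the graphs, because
  the cone hypothesis of \<open>light_cones_imp_lipschitz\<close> reaches down to height
  \<open>h / 2\<close> with \<open>h\<close> above that tolerance.\<close>

definition annular :: "nat \<Rightarrow> pt \<Rightarrow> real \<Rightarrow> 'i set" where
  "annular n x h = {i\<in>S. rp (Suc n) / 2 < norm (P i - x) \<and> norm (P i - x) \<le> h}"

definition mass :: "nat \<Rightarrow> pt \<Rightarrow> real \<Rightarrow> nat \<Rightarrow> nat \<Rightarrow> real" where
  "mass n x h b j = sum w {i\<in>annular n x h. sees b j (P i - x)}"

definition hit :: "nat \<Rightarrow> nat \<Rightarrow> pt \<Rightarrow> nat \<Rightarrow> bool" where
  "hit n k x l \<longleftrightarrow> (\<exists>i\<in>annular n x (4 * rp n). sees (a k) (l div 2 ^ (\<Lambda> - a k)) (P i - x))"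

text \<open>The threshold is \<open>q\<close> times \<open>h * (2 * pi / 2 ^ b)\<close>, the
  half-width of a tube containing the sector, so that \<open>heavy\<close> can be compared with
  \<open>heavy_tube\<close>.\<close>

definition heavy :: "nat \<Rightarrow> pt \<Rightarrow> nat \<Rightarrow> bool" where
  "heavy n x l \<longleftrightarrow> (\<exists>b\<in>{a n..a (n + g)}. \<exists>h. rp (Suc n) \<le> h \<and> h \<le> 4 * rp n \<and>
     q * h * (2 * pi) / 2 ^ b < mass n x h b (l div 2 ^ (\<Lambda> - b)))"

definition bad :: "nat \<Rightarrow> pt \<Rightarrow> nat \<Rightarrow> bool" where
  "bad n x l \<longleftrightarrow> hit n (n + g) x l \<or> heavy n x l"

definition dense :: "nat \<Rightarrow> pt \<Rightarrow> nat \<Rightarrow> bool" where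
  "dense n x l \<longleftrightarrow> \<eta> * 2 ^ (\<Lambda> - a n) <
     card {l'. l' div 2 ^ (\<Lambda> - a n) = l div 2 ^ (\<Lambda> - a n) \<and> bad n x l'}"

text \<open>Balls met by the line after dilation by \<open>s\<close>. The value 2 absorbs the
  angular error of an arc, and 3 in addition a shift of the line by some \<open>w i\<close>.\<close>

definition tube_count :: "real \<Rightarrow> nat \<Rightarrow> real \<Rightarrow> real \<Rightarrow> nat" where
  "tube_count s k t c = card {b\<in>cov k. \<bar>fst b \<bullet> dir t - c\<bar> \<le> s * snd b}"

definition crowded :: "real \<Rightarrow> pt \<Rightarrow> bool" where
  "crowded t x \<longleftrightarrow> N * q < (\<Sum>k\<in>{n0..N}. real (tube_count 2 k t (x \<bullet> dir t)))"

definition heavy_tube :: "real \<Rightarrow> pt \<Rightarrow> bool" where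
  "heavy_tube t x \<longleftrightarrow> (\<exists>W\<ge>rs. q * W < sum w {i\<in>S. \<bar>(P i - x) \<bullet> dir t\<bar> \<le> W})"

lemma \<eta>01: "0 < \<eta>" "\<eta> < 1"
  using q one_less_power[of q 4] by (auto simp: \<eta>_def)

lemma annular_fin: "finite (annular n x h)" "annular n x h \<subseteq> S"
  using S_fin by (auto simp: annular_def)

lemma mass_split: "mass n x h b j \<le> mass n x h (Suc b) (2 * j) + mass n x h (Suc b) (2 * j + 1)"
proof -
  let ?A = "\<lambda>b j. {i\<in>annular n x h. sees b j (P i - x)}"
  have eq: "?A b j = ?A (Suc b) (2 * j) \<union> ?A (Suc b) (2 * j + 1)"
    by (auto simp: sees_def cell_split[of b j])
  have "0 \<le> sum w (?A (Suc b) (2 * j) \<inter> ?A (Suc b) (2 * j + 1))"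
    using annular_fin(2) w_nonneg by (intro sum_nonneg) blast
  moreover have "sum w (?A (Suc b) (2 * j) \<union> ?A (Suc b) (2 * j + 1)) + sum w (?A (Suc b) (2 * j) \<inter> ?A (Suc b) (2 * j + 1))
      = sum w (?A (Suc b) (2 * j)) + sum w (?A (Suc b) (2 * j + 1))"
    using annular_fin by (intro sum.union_inter) auto
  ultimately show ?thesis unfolding mass_def eq by linarith
qed

text \<open>\<open>bad\<close> is tailored to \<open>dyadic_mass_le_bad\<close>: a leaf that is not
  \<open>hit\<close> has an empty sector at the finest level, and one that is not
  \<open>heavy\<close> bounds the mass of all its coarser sectors. As \<open>\<eta> < 1\<close>, an
  arc that is not dense contains a good leaf to start from.\<close>

lemma cone_mass_le:
  assumes n: "n0 \<le> n" "n + g \<le> N" and nd: "\<not> dense n x l" and h: "rp (Suc n) \<le> h" "h \<le> 4 * rp n"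
  shows "mass n x h (a n) (l div 2 ^ (\<Lambda> - a n)) \<le> 4 * pi * q * h * \<eta> / 2 ^ a n"
proof -
  have aA: "a n \<le> a (n + g)" "a (n + g) \<le> \<Lambda>" "a n \<le> \<Lambda>"
    using a_mono[of n "n + g"] a_bound[of "n + g"] n by auto
  have hpos: "0 \<le> h" using h rp_pos[of "Suc n"] n g by auto
  define \<kappa> where "\<kappa> = q * h * (2 * pi) / 2 ^ \<Lambda>"
  have \<kappa>: "0 \<le> \<kappa>" using hpos q by (simp add: \<kappa>_def)
  have \<kappa>b: "\<kappa> * 2 ^ (\<Lambda> - b) = q * h * (2 * pi) / 2 ^ b" if "b \<le> \<Lambda>" for b
  proof -
    have "(2::real) ^ \<Lambda> = 2 ^ b * 2 ^ (\<Lambda> - b)" using that by (simp flip: power_add)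
    then show ?thesis by (simp add: \<kappa>_def)
  qed
  let ?B = "{l'. l' div 2 ^ (\<Lambda> - a n) = l div 2 ^ (\<Lambda> - a n) \<and> bad n x l'}"
  have cardB: "card ?B \<le> \<eta> * 2 ^ (\<Lambda> - a n)" using nd by (simp add: dense_def)
  have "\<exists>l'. l' div 2 ^ (\<Lambda> - a n) = l div 2 ^ (\<Lambda> - a n) \<and> \<not> bad n x l'"
  proof (rule ccontr)
    assume "\<not> ?thesis"
    then have "?B = {l'. l' div 2 ^ (\<Lambda> - a n) = l div 2 ^ (\<Lambda> - a n)}" by auto
    then have "card ?B = 2 ^ (\<Lambda> - a n)" by (simp add: card_div_eq(2))
    then show False using cardB \<eta>01 by simp
  qed
  then obtain l' where l': "l' div 2 ^ (\<Lambda> - a n) = l div 2 ^ (\<Lambda> - a n)" "\<not> bad n x l'" by auto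
  have "mass n x h (a n) (l div 2 ^ (\<Lambda> - a n)) \<le> 2 * \<kappa> * card ?B"
  proof (rule dyadic_mass_le_bad[where A = "a (n + g)" and a = "a n" and l = l'])
    show "mass n x h (a (n + g)) (m div 2 ^ (\<Lambda> - a (n + g))) \<le> 0" if "\<not> bad n x m" for m
    proof -
      have "{i\<in>annular n x h. sees (a (n + g)) (m div 2 ^ (\<Lambda> - a (n + g))) (P i - x)} = {}"
        using that h by (fastforce simp: bad_def hit_def annular_def)
      then show ?thesis unfolding mass_def by (simp only: sum.empty)
    qed
    show "mass n x h b (m div 2 ^ (\<Lambda> - b)) \<le> \<kappa> * 2 ^ (\<Lambda> - b)"
      if "\<not> bad n x m" "a n \<le> b" "b \<le> a (n + g)" for m b
    proof -
      have "b \<le> \<Lambda>" using that aA by simp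
      have "\<not> heavy n x m" using that by (simp add: bad_def)
      then have "mass n x h b (m div 2 ^ (\<Lambda> - b)) \<le> q * h * (2 * pi) / 2 ^ b"
        using that h unfolding heavy_def by (meson atLeastAtMost_iff not_less)
      then show ?thesis using \<kappa>b[OF \<open>b \<le> \<Lambda>\<close>] by simp
    qed
  qed (use aA \<kappa> mass_split l' in auto)
  also have "\<dots> \<le> 2 * \<kappa> * (\<eta> * 2 ^ (\<Lambda> - a n))" using cardB \<kappa> by (intro mult_left_mono) auto
  also have "\<dots> = 4 * pi * q * h * \<eta> / 2 ^ a n"
  proof -
    have "2 * \<kappa> * (\<eta> * 2 ^ (\<Lambda> - a n)) = 2 * \<eta> * (\<kappa> * 2 ^ (\<Lambda> - a n))" by (simp only: mult_ac)
    then show ?thesis unfolding \<kappa>b[OF aA(3)] by (simp add: mult_ac)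
  qed
  finally show ?thesis .
qed

text \<open>A sector of radius \<open>h\<close> over an arc of level \<open>b\<close> around
  \<open>t\<close> lies in the tube of half-width \<open>h * (2 * pi / 2 ^ b)\<close> about the line
  through \<open>x\<close> with normal \<open>dir t\<close>.\<close>

lemma not_heavy:
  assumes n: "n0 \<le> n" "n + g \<le> N" and t: "t \<in> cell \<Lambda> l" and "\<not> heavy_tube t x"
  shows "\<not> heavy n x l"
proof
  assume "heavy n x l"
  then obtain b h where b: "a n \<le> b" "b \<le> a (n + g)" and h: "rp (Suc n) \<le> h" "h \<le> 4 * rp n"
    and m: "q * h * (2 * pi) / 2 ^ b < mass n x h b (l div 2 ^ (\<Lambda> - b))" by (auto simp: heavy_def)
  have b\<Lambda>: "b \<le> \<Lambda>" using b a_bound[of "n + g"] n by auto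
  have tc: "t \<in> cell b (l div 2 ^ (\<Lambda> - b))" using cell_mono[OF b\<Lambda>] t by auto
  have rN: "0 < rm N" "rm N \<le> 1/100" using rm_pos[of N] rm_le_1[of N] n0 by auto
  have hN: "rm N \<le> h"
  proof -
    have "rm N \<le> rp N" using rm_le_rp[of N] n0 by auto
    also have "\<dots> \<le> rp (Suc n)" using rp_antimono[of "Suc n" N] n g by auto
    finally show ?thesis using h by simp
  qed
  define W where "W = h * (2 * pi / 2 ^ b)"
  \<comment> \<open>\<open>heavy_tube\<close> only speaks of widths from \<open>rs\<close> on. Both
    factors of \<open>W\<close> are at least \<open>rm N\<close>, which is why \<open>rs\<close> is
    quadratic in \<open>rm N\<close>.\<close>
  have "rs \<le> W"
  proof -
    have "2 * q * rm N \<le> 1 / 2 ^ a (n + g)"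
      using a_ge[of "n + g"] mult_left_mono[OF rmN_le_rm[of "n + g"], of "2 * q"] n q by linarith
    also have "\<dots> \<le> 1 / 2 ^ b" using b by (intro divide_left_mono) auto
    finally have *: "2 * q * rm N \<le> 1 / 2 ^ b" .
    have "rm N * 1 \<le> rm N * (2 * q)" using q rN by (intro mult_left_mono) auto
    with * have 1: "rm N \<le> 1 / 2 ^ b" by (simp add: mult_ac)
    have "1 / 2 ^ b \<le> 2 * pi / 2 ^ b" using pi_gt3 by (intro divide_right_mono) auto
    with 1 have "rm N \<le> 2 * pi / 2 ^ b" by simp
    then have "rm N * rm N \<le> h * (2 * pi / 2 ^ b)" using hN rN by (intro mult_mono) auto
    then show ?thesis using rs rN by (simp add: W_def power2_eq_square)
  qed
  have "mass n x h b (l div 2 ^ (\<Lambda> - b)) \<le> sum w {i\<in>S. \<bar>(P i - x) \<bullet> dir t\<bar> \<le> W}"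
    unfolding mass_def
  proof (intro sum_mono2)
    show "{i \<in> annular n x h. sees b (l div 2 ^ (\<Lambda> - b)) (P i - x)} \<subseteq> {i \<in> S. \<bar>(P i - x) \<bullet> dir t\<bar> \<le> W}"
    proof clarify
      fix i assume i: "i \<in> annular n x h" "sees b (l div 2 ^ (\<Lambda> - b)) (P i - x)"
      then obtain s where s: "s \<in> cell b (l div 2 ^ (\<Lambda> - b))" "(P i - x) \<bullet> dir s = 0" by (auto simp: sees_def)
      have "\<bar>(P i - x) \<bullet> dir t\<bar> \<le> norm (P i - x) * (2 * pi * \<bar>t - s\<bar>)" by (rule inner_dir_close[OF s(2)])
      also have "\<dots> \<le> h * (2 * pi * (1 / 2 ^ b))"
        using i cell_diam[OF tc s(1)] hN rN by (intro mult_mono) (auto simp: annular_def)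
      finally show "i \<in> S \<and> \<bar>(P i - x) \<bullet> dir t\<bar> \<le> W" using i by (auto simp: W_def annular_def)
    qed
  qed (use S_fin w_nonneg in auto)
  also have "\<dots> \<le> q * W" using assms(4) \<open>rs \<le> W\<close> by (auto simp: heavy_tube_def not_less)
  finally show False using m by (simp add: W_def mult_ac)
qed

section \<open>Few bad scales on a typical line\<close>

lemma hit_mono:
  assumes "n0 \<le> k" "k \<le> k'" "k' \<le> N" "hit n k' x l"
  shows "hit n k x l"
proof -
  have "a k \<le> a k'" "a k' \<le> \<Lambda>" using a_mono[of k k'] a_bound[of k'] assms by auto
  then have "cell (a k') (l div 2 ^ (\<Lambda> - a k')) \<subseteq> cell (a k) (l div 2 ^ (\<Lambda> - a k))" by (rule cell_div_mono)
  then show ?thesis using assms(4) unfolding hit_def sees_def by blast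
qed

text \<open>Each hit at \<open>n\<close> yields a point of \<open>E\<close> at distance about
  \<open>r_n\<close> from \<open>x\<close>, and a ball of \<open>cov k\<close> that contains this
  point and is near the line. The ball almost determines \<open>n\<close>: the same ball for scales
  at least 5 apart would put both points at nearly the same distance from \<open>x\<close>.\<close>

lemma hits_le_tube_count:
  assumes t: "t \<in> cell \<Lambda> l" and k: "n0 \<le> k" "k \<le> N"
  shows "card {n. n0 \<le> n \<and> n + 5 \<le> k \<and> hit n k x l} \<le> 5 * tube_count 2 k t (x \<bullet> dir t)"
proof -
  let ?A = "{n. n0 \<le> n \<and> n + 5 \<le> k \<and> hit n k x l}"
  define Q where "Q n y b \<longleftrightarrow> y \<in> E \<and> rp (Suc n) / 2 < norm (y - x) \<and> norm (y - x) \<le> 4 * rp n \<and> b \<in> cov k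
      \<and> y \<in> ball (fst b) (snd b) \<and> \<bar>fst b \<bullet> dir t - x \<bullet> dir t\<bar> \<le> 2 * snd b" for n y b
  have "\<exists>y b. Q n y b" if n: "n \<in> ?A" for n
  proof -
    obtain i s where i: "i \<in> annular n x (4 * rp n)" and s: "s \<in> cell (a k) (l div 2 ^ (\<Lambda> - a k))"
      "(P i - x) \<bullet> dir s = 0" using n by (auto simp: hit_def sees_def)
    have "P i \<in> E" using i P_in annular_fin(2) by blast
    then obtain b where b: "b \<in> cov k" "P i \<in> ball (fst b) (snd b)" using cov_cover[OF k] by blast
    have rad: "rm k \<le> snd b" using cov_rad[OF k b(1)] by simp
    have tc: "t \<in> cell (a k) (l div 2 ^ (\<Lambda> - a k))" using cell_mono[of "a k" \<Lambda> l] a_bound[OF k] t by auto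
    have nN: "n0 \<le> n" "n \<le> N" using n k by auto
    have rmk: "0 < rm k" using rm_pos k by auto
    have "\<bar>(P i - x) \<bullet> dir t\<bar> \<le> norm (P i - x) * (2 * pi * \<bar>t - s\<bar>)" by (rule inner_dir_close[OF s(2)])
    also have "\<dots> \<le> (4 * rp n) * (2 * pi * (1 / 2 ^ a k))"
      using i cell_diam[OF tc s(1)] by (intro mult_mono) (use rp_pos[OF nN] in \<open>auto simp: annular_def\<close>)
    \<comment> \<open>With \<open>pi\<close> rounded up to \<open>15/4\<close> the product of the
      constants is 120, the factor in the hypothesis \<open>rp_small\<close>.\<close>
    also have "\<dots> \<le> (4 * rp n) * (2 * (15/4) * (4 * q * rm k))"
      using a_le[OF k] rp_pos[OF nN] pi_less_4 pi_approx by (intro mult_mono) auto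
    also have "\<dots> = (120 * q * rp n) * rm k" by simp
    also have "\<dots> \<le> 1 * rm k" using rp_small[OF nN] rmk by (intro mult_right_mono) auto
    finally have 1: "\<bar>P i \<bullet> dir t - x \<bullet> dir t\<bar> \<le> snd b" using rad by (simp add: inner_diff_left)
    have "\<bar>(fst b - P i) \<bullet> dir t\<bar> \<le> norm (fst b - P i)" by (rule abs_inner_dir_le)
    also have "\<dots> \<le> snd b" using b(2) by (simp add: dist_norm)
    finally have 2: "\<bar>fst b \<bullet> dir t - P i \<bullet> dir t\<bar> \<le> snd b" by (simp add: inner_diff_left)
    have "\<bar>fst b \<bullet> dir t - x \<bullet> dir t\<bar> \<le> 2 * snd b" using 1 2 by linarith
    then show ?thesis using i b \<open>P i \<in> E\<close>
      by (intro exI[of _ "P i"] exI[of _ b]) (auto simp: annular_def Q_def)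
  qed
  then obtain y b where "\<And>n. n \<in> ?A \<Longrightarrow> Q n (y n) (b n)" by metis
  then have yb: "\<And>n. n \<in> ?A \<Longrightarrow> y n \<in> E \<and> rp (Suc n) / 2 < norm (y n - x) \<and> norm (y n - x) \<le> 4 * rp n
      \<and> b n \<in> cov k \<and> y n \<in> ball (fst (b n)) (snd (b n)) \<and> \<bar>fst (b n) \<bullet> dir t - x \<bullet> dir t\<bar> \<le> 2 * snd (b n)"
    unfolding Q_def by blast
  have "?A \<subseteq> {..k}" by auto
  then have finA: "finite ?A" using finite_subset by blast
  have "card ?A \<le> 5 * card (b ` ?A)"
  proof (rule card_le_fibres[OF finA])
    show "0 < (5::nat)" by simp
  next
    fix m n assume mn: "m \<in> ?A" "n \<in> ?A" "b m = b n" "m < n"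
    show "n < m + 5"
    proof (rule ccontr)
      assume "\<not> n < m + 5"
      then have le: "m + 5 \<le> n" "m + 5 \<le> k" "n + 5 \<le> k" "n0 \<le> m" using mn by auto
      have p: "0 < rp (Suc m)" using rp_pos[of "Suc m"] le k by auto
      have "rp n \<le> rp (Suc m + 4)" using rp_antimono[of "Suc m + 4" n] le k by auto
      moreover have "rp k \<le> rp (Suc m + 4)" using rp_antimono[of "Suc m + 4" k] le k by auto
      \<comment> \<open>The offset 5 supplies four halvings below \<open>rp (Suc m)\<close>. Then
        \<open>y m\<close> is within \<open>1/8 + 4/16 = 3/8\<close> of \<open>rp (Suc m)\<close>
        from \<open>x\<close>, against the lower bound \<open>1/2\<close> of the annulus.\<close>
      moreover have "rp (Suc m + 4) * 16 \<le> rp (Suc m)" using rp_decay[of "Suc m" 4] le k by auto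
      ultimately have d: "rp n \<le> rp (Suc m) / 16" "rp k \<le> rp (Suc m) / 16" by auto
      have "norm (y m - y n) \<le> norm (y m - fst (b m)) + norm (fst (b m) - y n)"
        by (metis norm_triangle_ineq diff_add_cancel add_diff_eq)
      also have "\<dots> \<le> 2 * rp k"
        using yb[OF mn(1)] yb[OF mn(2)] cov_rad[OF k, of "b n"] mn(3) by (auto simp: dist_norm norm_minus_commute)
      finally have "norm (y m - y n) \<le> rp (Suc m) / 8" using d by simp
      moreover have "norm (y m - x) \<le> norm (y m - y n) + norm (y n - x)"
        by (metis norm_triangle_ineq diff_add_cancel add_diff_eq)
      ultimately show False using yb[OF mn(1)] yb[OF mn(2)] d p by linarith
    qed
  qed
  also have "card (b ` ?A) \<le> tube_count 2 k t (x \<bullet> dir t)"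
    unfolding tube_count_def using yb cov_fin[OF k] by (intro card_mono) auto
  finally show ?thesis by simp
qed

text \<open>Count pairs \<open>(n, k)\<close> with \<open>n + 5 \<le> k \<le> n + g\<close>. By
  \<open>hit_mono\<close> a hit at resolution \<open>n + g\<close> persists at all these
  \<open>k\<close>, giving \<open>g - 4\<close> pairs per \<open>n\<close>, while each
  \<open>k\<close> is controlled by its tube count.\<close>

lemma few_hits:
  assumes t: "t \<in> cell \<Lambda> l" and nc: "\<not> crowded t x"
  shows "card {n\<in>{n0..N - g}. hit n (n + g) x l} * (real g - 4) \<le> 5 * N * q"
proof -
  let ?H = "{n\<in>{n0..N - g}. hit n (n + g) x l}"
  have "card ?H * (g - 4) = (\<Sum>n\<in>?H. card {n + 5..n + g})" by simp
  also have "\<dots> = card (SIGMA n:?H. {n + 5..n + g})" by simp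
  also have "\<dots> \<le> card (SIGMA k:{n0..N}. {n. n0 \<le> n \<and> n + 5 \<le> k \<and> hit n k x l})"
  proof (rule card_inj_on_le[where f = prod.swap])
    show "prod.swap ` (SIGMA n:?H. {n + 5..n + g}) \<subseteq> (SIGMA k:{n0..N}. {n. n0 \<le> n \<and> n + 5 \<le> k \<and> hit n k x l})"
      using n0 hit_mono by (fastforce simp: image_def)
    have "finite {n. n0 \<le> n \<and> n + 5 \<le> k \<and> hit n k x l}" for k
      by (rule finite_subset[of _ "{..k}"]) auto
    then show "finite (SIGMA k:{n0..N}. {n. n0 \<le> n \<and> n + 5 \<le> k \<and> hit n k x l})" by auto
  qed auto
  also have "\<dots> = (\<Sum>k\<in>{n0..N}. card {n. n0 \<le> n \<and> n + 5 \<le> k \<and> hit n k x l})"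
  proof (rule card_SigmaI)
    show "\<forall>k\<in>{n0..N}. finite {n. n0 \<le> n \<and> n + 5 \<le> k \<and> hit n k x l}"
    proof
      fix k show "finite {n. n0 \<le> n \<and> n + 5 \<le> k \<and> hit n k x l}"
        by (rule finite_subset[of _ "{..k}"]) auto
    qed
  qed simp
  also have "\<dots> \<le> (\<Sum>k\<in>{n0..N}. 5 * tube_count 2 k t (x \<bullet> dir t))"
    using hits_le_tube_count[OF t] by (intro sum_mono) auto
  finally have "real (card ?H * (g - 4)) \<le> real (\<Sum>k\<in>{n0..N}. 5 * tube_count 2 k t (x \<bullet> dir t))"
    by (simp only: of_nat_le_iff)
  also have "\<dots> = 5 * (\<Sum>k\<in>{n0..N}. real (tube_count 2 k t (x \<bullet> dir t)))" by (simp add: sum_distrib_left)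
  also have "\<dots> \<le> 5 * (N * q)" using nc by (simp add: crowded_def)
  finally show ?thesis using g by (simp add: of_nat_diff)
qed

section \<open>Exceptional lines\<close>

text \<open>Markov's inequality for the number of balls met, whose integral over the lines is at
  most \<open>6 * L\<close> per scale. Since \<open>w i\<close> is below all radii of the covers,
  count 2 at \<open>P i\<close> becomes count 3 on the whole shadow of
  \<open>cball (P i) (w i)\<close>.\<close>

lemma crowded_small:
  obtains Z where "Z \<in> sets borel" "emeasure lborel Z \<le> ennreal (6 * L / q)"
    "\<And>i c. i \<in> S \<Longrightarrow> crowded t (P i) \<Longrightarrow> \<bar>c - P i \<bullet> dir t\<bar> \<le> w i \<Longrightarrow> c \<in> Z"
proof -
  define I where "I b = {fst b \<bullet> dir t - 3 * snd b..fst b \<bullet> dir t + 3 * snd b}" for b :: "pt \<times> real"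
  define f where "f c = (\<Sum>k\<in>{n0..N}. \<Sum>b\<in>cov k. indicator (I b) c :: ennreal)" for c :: real
  have f: "f \<in> borel_measurable lborel" unfolding f_def I_def by measurable
  have feq: "f c = ennreal (\<Sum>k\<in>{n0..N}. real (tube_count 3 k t c))" for c
  proof -
    have "(\<Sum>b\<in>cov k. indicator (I b) c) = ennreal (real (tube_count 3 k t c))" if "k \<in> {n0..N}" for k
    proof -
      have "(\<Sum>b\<in>cov k. indicator (I b) c :: ennreal) = (\<Sum>b\<in>cov k. of_bool (\<bar>fst b \<bullet> dir t - c\<bar> \<le> 3 * snd b))"
        by (intro sum.cong) (auto simp: I_def indicator_def)
      also have "\<dots> = of_nat (tube_count 3 k t c)"
        using cov_fin[of k] that by (simp add: tube_count_def Int_def)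
      finally show ?thesis by (simp add: ennreal_of_nat_eq_real_of_nat)
    qed
    then show ?thesis unfolding f_def by (simp add: sum_nonneg sum_ennreal)
  qed
  have int: "(\<integral>\<^sup>+c. f c \<partial>lborel) \<le> ennreal (N * (6 * L))"
  proof -
    have "(\<integral>\<^sup>+c. f c \<partial>lborel) = (\<Sum>k\<in>{n0..N}. \<Sum>b\<in>cov k. emeasure lborel (I b))"
    proof -
      have [measurable]: "I b \<in> sets borel" for b by (simp add: I_def)
      have "(\<integral>\<^sup>+c. f c \<partial>lborel) = (\<Sum>k\<in>{n0..N}. \<integral>\<^sup>+c. (\<Sum>b\<in>cov k. indicator (I b) c) \<partial>lborel)"
        unfolding f_def by (rule nn_integral_sum) simp
      also have "\<dots> = (\<Sum>k\<in>{n0..N}. \<Sum>b\<in>cov k. \<integral>\<^sup>+c. indicator (I b) c \<partial>lborel)"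
        by (intro sum.cong refl nn_integral_sum) simp
      finally show ?thesis by simp
    qed
    also have "\<dots> = (\<Sum>k\<in>{n0..N}. \<Sum>b\<in>cov k. ennreal (6 * snd b))"
    proof (intro sum.cong refl)
      fix k b assume kb: "k \<in> {n0..N}" "b \<in> cov k"
      then have "0 \<le> snd b" using cov_rad[of k b] rm_pos[of k] by auto
      then show "emeasure lborel (I b) = ennreal (6 * snd b)" by (simp add: I_def)
    qed
    also have "\<dots> = (\<Sum>k\<in>{n0..N}. ennreal (\<Sum>b\<in>cov k. 6 * snd b))"
    proof (intro sum.cong refl sum_ennreal)
      fix k b assume kb: "k \<in> {n0..N}" "b \<in> cov k"
      then show "0 \<le> 6 * snd b" using cov_rad[of k b] rm_pos[of k] by auto
    qed
    also have "\<dots> \<le> (\<Sum>k\<in>{n0..N}. ennreal (6 * L))"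
      using cov_sum by (intro sum_mono ennreal_leI) (auto simp flip: sum_distrib_left)
    also have "\<dots> = ennreal (card {n0..N} * (6 * L))" using L by (simp add: ennreal_mult ennreal_of_nat_eq_real_of_nat)
    also have "\<dots> \<le> ennreal (N * (6 * L))" using L n0 by (intro ennreal_leI mult_right_mono) auto
    finally show ?thesis .
  qed
  have Nq: "0 < N * q" using q n0 g by auto
  define Z where "Z = {c\<in>UNIV. 1 \<le> ennreal (1 / (N * q)) * f c}"
  have "Z \<in> sets borel" using f unfolding Z_def by simp
  moreover have "emeasure lborel Z \<le> ennreal (6 * L / q)"
  proof -
    have "emeasure lborel Z \<le> ennreal (1 / (N * q)) * (\<integral>\<^sup>+c. f c * indicator UNIV c \<partial>lborel)"
      unfolding Z_def using f by (intro nn_integral_Markov_inequality) auto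
    also have "\<dots> \<le> ennreal (1 / (N * q)) * ennreal (N * (6 * L))" using int by (intro mult_left_mono) auto
    also have "\<dots> = ennreal (6 * L / q)" using Nq L by (subst ennreal_mult[symmetric]) auto
    finally show ?thesis .
  qed
  moreover have "c \<in> Z" if i: "i \<in> S" "crowded t (P i)" "\<bar>c - P i \<bullet> dir t\<bar> \<le> w i" for i c
  proof -
    have "N * q \<le> (\<Sum>k\<in>{n0..N}. real (tube_count 2 k t (P i \<bullet> dir t)))" using i by (simp add: crowded_def)
    also have "\<dots> \<le> (\<Sum>k\<in>{n0..N}. real (tube_count 3 k t c))"
    proof (intro sum_mono)
      fix k assume k: "k \<in> {n0..N}"
      have "tube_count 2 k t (P i \<bullet> dir t) \<le> tube_count 3 k t c" unfolding tube_count_def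
      proof (intro card_mono)
        show "{b \<in> cov k. \<bar>fst b \<bullet> dir t - P i \<bullet> dir t\<bar> \<le> 2 * snd b} \<subseteq> {b \<in> cov k. \<bar>fst b \<bullet> dir t - c\<bar> \<le> 3 * snd b}"
        proof
          fix b assume b: "b \<in> {b \<in> cov k. \<bar>fst b \<bullet> dir t - P i \<bullet> dir t\<bar> \<le> 2 * snd b}"
          have "rm k \<le> snd b" using cov_rad[of k b] b k by auto
          then have "w i \<le> snd b" using w_le[OF i(1)] rs_le_rmN rmN_le_rm[of k] k by auto
          then show "b \<in> {b \<in> cov k. \<bar>fst b \<bullet> dir t - c\<bar> \<le> 3 * snd b}" using b i(3) by auto
        qed
      qed (use cov_fin k in auto)
      then show "real (tube_count 2 k t (P i \<bullet> dir t)) \<le> real (tube_count 3 k t c)" by simp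
    qed
    finally have "1 \<le> 1 / (N * q) * (\<Sum>k\<in>{n0..N}. real (tube_count 3 k t c))" using Nq by (simp add: field_simps)
    then have "ennreal 1 \<le> ennreal (1 / (N * q) * (\<Sum>k\<in>{n0..N}. real (tube_count 3 k t c)))" by (rule ennreal_leI)
    also have "\<dots> = ennreal (1 / (N * q)) * f c" unfolding feq using Nq by (intro ennreal_mult) (auto intro!: sum_nonneg)
    finally show ?thesis by (simp add: Z_def)
  qed
  ultimately show ?thesis by (rule that)
qed

text \<open>A weak-type maximal estimate: by Vitali, disjoint heavy tubes each carry more than
  \<open>q * W\<close> of a total weight at most \<open>2 * L\<close>. Threefold dilation covers the
  shadows as well, because \<open>w i \<le> rs \<le> W j\<close>.\<close>

lemma heavy_tube_small:
  obtains Z where "Z \<in> sets borel" "emeasure lborel Z \<le> ennreal (12 * L / q)"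
    "\<And>i c. i \<in> S \<Longrightarrow> heavy_tube t (P i) \<Longrightarrow> \<bar>c - P i \<bullet> dir t\<bar> \<le> w i \<Longrightarrow> c \<in> Z"
proof -
  define V where "V = {i\<in>S. heavy_tube t (P i)}"
  define u where "u i = P i \<bullet> dir t" for i
  have "\<forall>i\<in>V. \<exists>W. rs \<le> W \<and> q * W < sum w {j\<in>S. \<bar>u j - u i\<bar> \<le> W}"
    unfolding V_def heavy_tube_def u_def by (auto simp: inner_diff_left)
  then obtain W where W: "\<And>i. i \<in> V \<Longrightarrow> rs \<le> W i \<and> q * W i < sum w {j\<in>S. \<bar>u j - u i\<bar> \<le> W i}" by metis
  have V: "finite V" "V \<subseteq> S" using S_fin by (auto simp: V_def)
  have Wpos: "0 \<le> W i" if "i \<in> V" for i using W[OF that] rs by auto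
  obtain D where D: "D \<subseteq> V" "\<And>i j. i \<in> D \<Longrightarrow> j \<in> D \<Longrightarrow> i \<noteq> j \<Longrightarrow> W i + W j < \<bar>u i - u j\<bar>"
    "\<And>i. i \<in> V \<Longrightarrow> \<exists>j\<in>D. \<bar>u i - u j\<bar> \<le> 2 * W j"
    by (rule finite_vitali_real[where A = V and r = W and u = u]) (use V Wpos in auto)
  have finD: "finite D" using D(1) V(1) finite_subset by blast
  have "q * sum W D = (\<Sum>i\<in>D. q * W i)" by (simp add: sum_distrib_left)
  also have "\<dots> \<le> (\<Sum>i\<in>D. sum w {j\<in>S. \<bar>u j - u i\<bar> \<le> W i})"
    using W D(1) by (intro sum_mono) (auto intro: less_imp_le)
  also have "\<dots> = sum w (\<Union>i\<in>D. {j\<in>S. \<bar>u j - u i\<bar> \<le> W i})"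
  proof (intro sum.UNION_disjoint[symmetric] ballI impI)
    fix i j assume "i \<in> D" "j \<in> D" "i \<noteq> j"
    from D(2)[OF this] show "{k\<in>S. \<bar>u k - u i\<bar> \<le> W i} \<inter> {k\<in>S. \<bar>u k - u j\<bar> \<le> W j} = {}" by auto
  qed (use finD S_fin in auto)
  also have "\<dots> \<le> sum w S" using S_fin w_nonneg by (intro sum_mono2) auto
  also have "\<dots> \<le> 2 * L" by (rule w_sum)
  finally have sumW: "sum W D \<le> 2 * L / q" using q by (simp add: field_simps)
  let ?Z = "\<Union>j\<in>D. {u j - 3 * W j..u j + 3 * W j}"
  have "?Z \<in> sets borel" using finD by (intro sets.finite_UN) auto
  moreover have "emeasure lborel ?Z \<le> ennreal (12 * L / q)"
  proof -
    have "emeasure lborel ?Z \<le> ennreal (2 * (\<Sum>j\<in>D. 3 * W j))"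
      using finD Wpos D(1) by (intro emeasure_UN_Icc_le) auto
    also have "(\<Sum>j\<in>D. 3 * W j) = 3 * sum W D" by (simp add: sum_distrib_left)
    also have "ennreal (2 * (3 * sum W D)) \<le> ennreal (12 * L / q)" using sumW by (intro ennreal_leI) auto
    finally show ?thesis .
  qed
  moreover have "c \<in> ?Z" if i: "i \<in> S" "heavy_tube t (P i)" "\<bar>c - P i \<bullet> dir t\<bar> \<le> w i" for i c
  proof -
    have "i \<in> V" using i by (simp add: V_def)
    then obtain j where j: "j \<in> D" "\<bar>u i - u j\<bar> \<le> 2 * W j" using D(3) by blast
    have "w i \<le> W j" using w_le[OF i(1)] W[of j] j D(1) by auto
    then have "c \<in> {u j - 3 * W j..u j + 3 * W j}" using i(3) j(2) unfolding u_def by auto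
    then show ?thesis using j(1) by blast
  qed
  ultimately show ?thesis by (rule that)
qed

section \<open>Lipschitz pieces in a fixed direction\<close>

text \<open>The leaf keeps a distance of \<open>2 ^ (\<Lambda> - a n - \<beta>)\<close> leaves from
  both ends of its arc. The second inequality is strict because the leaf itself has width
  one.\<close>

definition central :: "nat \<Rightarrow> nat \<Rightarrow> bool" where
  "central n l \<longleftrightarrow> 2 ^ (\<Lambda> - a n - \<beta>) \<le> l mod 2 ^ (\<Lambda> - a n) \<and>
     l mod 2 ^ (\<Lambda> - a n) + 2 ^ (\<Lambda> - a n - \<beta>) < 2 ^ (\<Lambda> - a n)"

text \<open>The margin is \<open>1 / 2 ^ (a n + \<beta>)\<close>. It is at least \<open>rm n\<close>
  because \<open>2 ^ \<beta> \<le> 2 * q\<close> and the arc is at least \<open>2 * q * rm n\<close>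
  long; this is why arcs are \<open>q\<close> times longer than the aperture
  \<open>rm n\<close>.\<close>

lemma central_cell:
  assumes n: "n0 \<le> n" "n \<le> N" and t: "t \<in> cell \<Lambda> l" and inn: "central n l" and t': "\<bar>t' - t\<bar> \<le> rm n"
  shows "t' \<in> cell (a n) (l div 2 ^ (\<Lambda> - a n))"
proof -
  define m where "m = (2::nat) ^ (\<Lambda> - a n)"
  define s where "s = (2::nat) ^ (\<Lambda> - a n - \<beta>)"
  define j where "j = l div m"
  have b: "a n + \<beta> \<le> \<Lambda>" using a_bound n by auto
  have 2: "(2::real) ^ \<Lambda> = 2 ^ a n * 2 ^ \<beta> * s" "(2::real) ^ \<Lambda> = 2 ^ a n * m"
    using b by (auto simp: s_def m_def simp flip: power_add)
  have "2 * q * rm n \<le> 1 / 2 ^ a n" by (rule a_ge[OF n])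
  moreover have "2 ^ \<beta> * rm n \<le> 2 * q * rm n" using \<beta> rm_pos[OF n] by (intro mult_right_mono) auto
  ultimately have "2 ^ \<beta> * rm n \<le> 1 / 2 ^ a n" by simp
  then have "rm n \<le> 1 / (2 ^ a n * 2 ^ \<beta>)" by (simp add: field_simps)
  also have "\<dots> = s / 2 ^ \<Lambda>" unfolding 2 by (simp add: s_def)
  finally have r: "rm n \<le> s / 2 ^ \<Lambda>" .
  have l: "l = j * m + l mod m" by (simp add: j_def)
  have "j * m + s \<le> l" "l + 1 + s \<le> (j + 1) * m" using inn l unfolding central_def m_def[symmetric] s_def[symmetric]
    by (auto simp: algebra_simps)
  then have "real (j * m + s) \<le> real l" "real (l + 1 + s) \<le> real ((j + 1) * m)" by (simp_all only: of_nat_le_iff)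
  then have "real j * m + s \<le> l" "real l + 1 + s \<le> (real j + 1) * m" by (simp_all add: algebra_simps)
  then have "(real j * m + s) / 2 ^ \<Lambda> \<le> l / 2 ^ \<Lambda>" "(real l + 1 + s) / 2 ^ \<Lambda> \<le> (real j + 1) * m / 2 ^ \<Lambda>"
    by (intro divide_right_mono; simp)+
  then have "real j * m / 2 ^ \<Lambda> + s / 2 ^ \<Lambda> \<le> l / 2 ^ \<Lambda>" "(real l + 1) / 2 ^ \<Lambda> + s / 2 ^ \<Lambda> \<le> (real j + 1) * m / 2 ^ \<Lambda>"
    by (simp_all only: add_divide_distrib)
  moreover have "real l / 2 ^ \<Lambda> \<le> t" "t < (real l + 1) / 2 ^ \<Lambda>" using t by (auto simp: cell_def)
  ultimately have "real j * m / 2 ^ \<Lambda> \<le> t'" "t' < (real j + 1) * m / 2 ^ \<Lambda>" using r t' by linarith+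
  moreover have "0 < m" by (simp add: m_def)
  ultimately show ?thesis unfolding cell_def j_def[unfolded m_def, symmetric] 2(2) by simp
qed

text \<open>\<open>light_cones_imp_lipschitz\<close> in the frame \<open>dir t\<close>,
  \<open>nrm t\<close>, with aperture \<open>rm n\<close> and tolerance \<open>rp (Suc n)\<close>,
  the parameters at which \<open>rect_const\<close> is assumed small. \<open>U\<close> is the
  deleted part and \<open>Z\<close> the projection of \<open>E\<close> near the graph.\<close>

lemma lipschitz_piece:
  assumes n: "n0 \<le> n" "n + g \<le> N" and t: "t \<in> cell \<Lambda> l" and inn: "central n l" and b: "b \<in> cov n"
  obtains U Z where "U \<subseteq> S" "sum w U \<le> snd b / q" "Z \<in> sets borel" "emeasure lborel Z \<le> ennreal (4 * snd b / q)"
    "\<And>i z. i \<in> S - U \<Longrightarrow> P i \<in> ball (fst b) (snd b) \<Longrightarrow> \<not> dense n (P i) l \<Longrightarrow> z \<in> E \<Longrightarrow> dist z (P i) \<le> w i \<Longrightarrow> z \<bullet> dir t \<in> Z"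
proof -
  define R where "R = {i\<in>S. P i \<in> ball (fst b) (snd b) \<and> \<not> dense n (P i) l}"
  define u where "u i = P i \<bullet> dir t" for i
  define v where "v i = P i \<bullet> nrm t" for i
  define r where "r = rm n"
  define \<epsilon> where "\<epsilon> = rp (Suc n)"
  define \<rho> where "\<rho> = snd b"
  \<comment> \<open>The bound of \<open>cone_mass_le\<close> at radius \<open>2 * h\<close>, divided
    by \<open>h\<close>.\<close>
  define \<Gamma> where "\<Gamma> = 8 * pi * q * \<eta> / 2 ^ a n"
  have nN: "n \<le> N" "Suc n \<le> N" "n < N" using n g by auto
  have r: "0 < r" "r \<le> 1/100" using rm_pos rm_le_1 n nN by (auto simp: r_def)
  have \<epsilon>: "0 < \<epsilon>" "rm N \<le> \<epsilon>"
  proof -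
    show "0 < \<epsilon>" using rp_pos[of "Suc n"] n nN by (auto simp: \<epsilon>_def)
    have "rm N \<le> rp N" using rm_le_rp[of N] n0 by auto
    also have "\<dots> \<le> \<epsilon>" unfolding \<epsilon>_def using rp_antimono[of "Suc n" N] n nN by auto
    finally show "rm N \<le> \<epsilon>" .
  qed
  have \<rho>: "r \<le> \<rho>" "\<rho> \<le> rp n" "0 < \<rho>" using cov_rad[OF n(1) nN(1) b] r by (auto simp: r_def \<rho>_def)
  have close: "norm (P i - fst b) \<le> \<rho>" if "i \<in> R" for i
    using that by (auto simp: R_def \<rho>_def dist_norm norm_minus_commute)
  have diff: "u j - u i = (P j - P i) \<bullet> dir t" "v j - v i = (P j - P i) \<bullet> nrm t" for i j
    by (simp_all add: u_def v_def inner_diff_left)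
  obtain F U where F: "(1/r)-lipschitz_on UNIV F" and U: "U \<subseteq> R" "sum w U \<le> 32 * \<Gamma> * \<rho> / r"
    and FU: "\<And>i. i \<in> R - U \<Longrightarrow> \<bar>v i - F (u i)\<bar> \<le> \<epsilon> / 2"
  proof (rule light_cones_imp_lipschitz[of R w r \<epsilon> \<rho> \<Gamma> u "fst b \<bullet> dir t" v])
    show "finite R" using S_fin by (auto simp: R_def)
    show "0 \<le> w i" if "i \<in> R" for i using that w_nonneg by (auto simp: R_def)
    show "0 \<le> \<Gamma>" using q \<eta>01 by (simp add: \<Gamma>_def)
    show "\<bar>u i - fst b \<bullet> dir t\<bar> \<le> \<rho>" if "i \<in> R" for i
      using close[OF that] abs_inner_dir_le[of "P i - fst b" t] by (simp add: u_def inner_diff_left)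
    show "\<bar>v i - v j\<bar> \<le> 2 * \<rho>" if "i \<in> R" "j \<in> R" for i j
    proof -
      have "norm (P i - P j) \<le> norm (P i - fst b) + norm (P j - fst b)"
        by (metis add_diff_cancel_right' diff_add_cancel norm_minus_commute norm_triangle_sub diff_diff_eq2 norm_triangle_ineq4 diff_right_commute)
      then show ?thesis using close[OF that(1)] close[OF that(2)] abs_inner_nrm_le[of "P i - P j" t]
        by (simp add: v_def inner_diff_left)
    qed
    fix i h assume iR: "i \<in> R" and h: "\<epsilon> < h" "h \<le> 2 * \<rho>"
    let ?K = "{j\<in>R. h/2 \<le> \<bar>v j - v i\<bar> \<and> \<bar>v j - v i\<bar> \<le> 3/2 * h \<and> \<bar>u j - u i\<bar> \<le> 5/2 * r * \<bar>v j - v i\<bar>}"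
    \<comment> \<open>As \<open>r \<le> 1/100\<close>, height at most \<open>3/2 * h\<close> forces
      norm at most \<open>2 * h\<close>. Since \<open>h \<le> 2 * rp n\<close>, this accounts for
      the outer radius \<open>4 * rp n\<close> in \<open>hit\<close> and
      \<open>heavy\<close>.\<close>
    have "sum w ?K \<le> mass n (P i) (2 * h) (a n) (l div 2 ^ (\<Lambda> - a n))"
      unfolding mass_def
    proof (intro sum_mono2 subsetI)
      fix j assume "j \<in> ?K"
      then have j: "j \<in> S" "h/2 \<le> \<bar>v j - v i\<bar>" "\<bar>v j - v i\<bar> \<le> 3/2 * h" "\<bar>u j - u i\<bar> \<le> 5/2 * r * \<bar>v j - v i\<bar>"
        by (auto simp: R_def)
      have "\<epsilon> / 2 < norm (P j - P i)" using j h abs_inner_nrm_le[of "P j - P i" t] unfolding diff by linarith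
      moreover have "norm (P j - P i) \<le> 2 * h"
      proof -
        have "5/2 * r * \<bar>v j - v i\<bar> \<le> 5/2 * (1/100) * (3/2 * h)" using j r h \<epsilon> by (intro mult_mono) auto
        then show ?thesis using norm_le_dir_nrm[of "P j - P i" t] j h \<epsilon> unfolding diff[symmetric] by linarith
      qed
      moreover have "sees (a n) (l div 2 ^ (\<Lambda> - a n)) (P j - P i)"
      proof -
        have "(P j - P i) \<bullet> nrm t \<noteq> 0" using j h \<epsilon> unfolding diff by auto
        then obtain t' where t': "(P j - P i) \<bullet> dir t' = 0" "\<bar>t' - t\<bar> \<le> 5/2 * r / (2 * pi)"
          using exists_orthogonal_dir[of "P j - P i" t "5/2 * r"] j(4) unfolding diff by blast
        have "5/2 * r / (2 * pi) \<le> r"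
          using r pi_gt3 mult_right_mono[of 3 pi r] by (simp add: field_simps)
        then have "t' \<in> cell (a n) (l div 2 ^ (\<Lambda> - a n))"
          using central_cell[OF n(1) nN(1) t inn, of t'] t' by (simp add: r_def)
        then show ?thesis using t' by (auto simp: sees_def)
      qed
      ultimately show "j \<in> {j \<in> annular n (P i) (2 * h). sees (a n) (l div 2 ^ (\<Lambda> - a n)) (P j - P i)}"
        using j(1) by (auto simp: annular_def \<epsilon>_def)
    next
      fix j assume "j \<in> {j \<in> annular n (P i) (2 * h). sees (a n) (l div 2 ^ (\<Lambda> - a n)) (P j - P i)} - ?K"
      then show "0 \<le> w j" using annular_fin(2)[of n "P i" "2 * h"] w_nonneg by blast
    qed (use annular_fin in auto)
    also have "\<dots> \<le> 4 * pi * q * (2 * h) * \<eta> / 2 ^ a n"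
      using iR h \<rho> \<epsilon> by (intro cone_mass_le[OF n]) (auto simp: R_def \<epsilon>_def)
    also have "\<dots> = \<Gamma> * h" by (simp add: \<Gamma>_def)
    finally show "sum w ?K \<le> \<Gamma> * h" .
  qed (use r \<epsilon> \<rho> in auto)
  have "sum w U \<le> \<rho> / q"
  proof -
    have "\<Gamma> = 8 * pi * q * \<eta> * (1 / 2 ^ a n)" by (simp add: \<Gamma>_def)
    also have "\<dots> \<le> 8 * pi * q * \<eta> * (4 * q * r)" unfolding r_def
      using a_le[OF n(1) nN(1)] q \<eta>01 by (intro mult_left_mono) auto
    finally have "32 * \<Gamma> * \<rho> / r \<le> 32 * (8 * pi * q * \<eta> * (4 * q * r)) * \<rho> / r"
      using r \<rho> by (intro divide_right_mono mult_right_mono mult_left_mono) auto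
    also have "\<dots> = (1024 * pi / q) * (\<rho> / q)" using q r by (simp add: \<eta>_def field_simps power_numeral_reduce)
    also have "\<dots> \<le> 1 * (\<rho> / q)" using pi_approx q \<rho> by (intro mult_right_mono) auto
    finally show ?thesis using U by simp
  qed
  moreover define c where "c = fst b \<bullet> dir t - 2 * \<rho>"
  moreover define d where "d = fst b \<bullet> dir t + 2 * \<rho>"
  define Z where "Z = {x \<in> {c..d}. \<exists>y. -\<epsilon> \<le> y \<and> y \<le> \<epsilon> \<and> x *\<^sub>R dir t + (F x + y) *\<^sub>R nrm t \<in> E}"
  have cd: "rm n \<le> d - c" "d - c = 4 * \<rho>" using \<rho> r by (auto simp: c_def d_def r_def)
  have Z: "Z \<in> sets borel" "emeasure lborel Z \<le> ennreal (rect_const E \<epsilon> (rm n) (1 / rm n) * (d - c))"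
    using rect_const_graph[OF compact_E _ F[unfolded r_def] norm_dir[of t] norm_nrm[of t] inner_dir_nrm cd(1), where \<epsilon> = \<epsilon>] r
    unfolding Z_def by (auto simp: r_def)
  have "rect_const E \<epsilon> (rm n) (1 / rm n) * (d - c) \<le> 1 / q * (4 * \<rho>)"
    unfolding cd \<epsilon>_def using rect[OF n(1) nN(3)] \<rho> by (intro mult_right_mono) auto
  then have "emeasure lborel Z \<le> ennreal (4 * \<rho> / q)" using Z(2) by (auto intro: order_trans ennreal_leI)
  moreover have "z \<bullet> dir t \<in> Z" if "i \<in> S - U" "P i \<in> ball (fst b) (snd b)" "\<not> dense n (P i) l" "z \<in> E" "dist z (P i) \<le> w i" for i z
  proof -
    have i: "i \<in> R - U" "i \<in> R" using that by (auto simp: R_def)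
    have zs: "norm (z - P i) \<le> rs" using that w_le[of i] by (auto simp: dist_norm)
    have du: "\<bar>z \<bullet> dir t - u i\<bar> \<le> rs" using abs_inner_dir_le[of "z - P i" t] zs by (simp add: u_def inner_diff_left)
    have dv: "\<bar>z \<bullet> nrm t - v i\<bar> \<le> rs" using abs_inner_nrm_le[of "z - P i" t] zs by (simp add: v_def inner_diff_left)
    have rN: "0 < rm N" "rm N \<le> r" using rm_pos[of N] rmN_le_rm[OF n(1) nN(1)] n0 by (auto simp: r_def)
    \<comment> \<open>Passing from \<open>P i\<close> to \<open>z\<close> moves the graph by at most
      \<open>rs / r\<close>, kept below \<open>rm N / 4\<close> by the quadratic bound on
      \<open>rs\<close>. The errors \<open>\<epsilon> / 2\<close>, \<open>\<epsilon> / 4\<close> and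
      \<open>\<epsilon> / 4\<close> add up to the tolerance.\<close>
    have "\<bar>F (z \<bullet> dir t) - F (u i)\<bar> \<le> 1/r * \<bar>z \<bullet> dir t - u i\<bar>"
      using lipschitz_onD[OF F, of "z \<bullet> dir t" "u i"] by (simp add: dist_real_def)
    also have "\<dots> \<le> 1/r * rs" using du r by (intro mult_left_mono) auto
    also have "\<dots> \<le> 1/rm N * ((rm N)\<^sup>2 / 4)" using rs rN by (intro mult_mono frac_le) auto
    also have "\<dots> = rm N / 4" using rN by (simp add: power2_eq_square)
    finally have dF: "\<bar>F (z \<bullet> dir t) - F (u i)\<bar> \<le> rm N / 4" .
    have "(rm N)\<^sup>2 \<le> rm N * 1" unfolding power2_eq_square using rN r by (intro mult_left_mono) auto
    then have rs4: "rs \<le> rm N / 4" using rs by simp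
    define y where "y = z \<bullet> nrm t - F (z \<bullet> dir t)"
    have "\<bar>y\<bar> \<le> \<epsilon>" unfolding y_def using FU[OF i(1)] dF dv rs4 \<epsilon>(2) by linarith
    moreover have "\<bar>u i - fst b \<bullet> dir t\<bar> \<le> \<rho>"
      using close[OF i(2)] abs_inner_dir_le[of "P i - fst b" t] by (simp add: u_def inner_diff_left)
    then have "z \<bullet> dir t \<in> {c..d}" using du rs4 rN \<rho> unfolding c_def d_def atLeastAtMost_iff by linarith
    moreover have "(z \<bullet> dir t) *\<^sub>R dir t + (F (z \<bullet> dir t) + y) *\<^sub>R nrm t = z"
      unfolding y_def using dir_nrm_decomp[of z t] by simp
    ultimately show ?thesis using \<open>z \<in> E\<close> unfolding Z_def by (auto simp: abs_le_iff intro!: exI[of _ y])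
  qed
  ultimately show ?thesis using that[of U Z] U Z by (auto simp: R_def \<rho>_def)
qed

section \<open>From typical directions to one good scale\<close>

text \<open>Unlike \<open>crowded\<close> and \<open>heavy_tube\<close>, this depends on the leaf
  and not on the exact direction, so it can be counted. The half leaves a gap of the size of the
  bound itself in the second moment estimate.\<close>

definition quiet :: "pt \<Rightarrow> nat \<Rightarrow> bool" where
  "quiet x l \<longleftrightarrow> card {n\<in>{n0..N - g}. bad n x l} \<le> \<eta> * (card {n0..N - g} / q) / 2"

lemma quietI:
  assumes t: "t \<in> cell \<Lambda> l" and "\<not> crowded t x" "\<not> heavy_tube t x"
  shows "quiet x l"
proof -
  have "{n\<in>{n0..N - g}. bad n x l} = {n\<in>{n0..N - g}. hit n (n + g) x l}"
    using not_heavy[OF _ _ t assms(3)] n0 by (auto simp: bad_def)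
  then have "card {n\<in>{n0..N - g}. bad n x l} * (real g - 4) \<le> 5 * N * q"
    using few_hits[OF t assms(2)] by simp
  also have "5 * N * q \<le> (\<eta> * (card {n0..N - g} / q) / 2) * (real g - 4)"
  proof -
    have "5 * N * q = (10 * N * q ^ 6) / (2 * q ^ 5)" using q by (simp add: field_simps power_numeral_reduce)
    also have "\<dots> \<le> (card {n0..N - g} * (real g - 4)) / (2 * q ^ 5)" using many(1) q by (intro divide_right_mono) auto
    also have "\<dots> = (\<eta> * (card {n0..N - g} / q) / 2) * (real g - 4)" using q by (simp add: \<eta>_def field_simps power_numeral_reduce)
    finally show ?thesis .
  qed
  finally show ?thesis unfolding quiet_def using g by (subst (asm) mult_le_cancel_right) auto
qed

text \<open>The 24 is 6 for crowded lines, 12 for heavy tubes and 6 for the balls of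
  \<open>cov n\<close>: per unit of radius, 2 from the shadows of the deleted part and 4 from the
  graph. Points with quiet but dense arcs are paid for by their weight.\<close>

lemma projection_le:
  assumes n: "n0 \<le> n" "n + g \<le> N" and t: "t \<in> cell \<Lambda> l" and inn: "central n l"
  shows "emeasure lborel ((\<lambda>z. z \<bullet> dir t) ` E) \<le>
     ennreal (24 * L / q + 2 * sum w {i\<in>S. quiet (P i) l \<and> dense n (P i) l})"
proof -
  have nN: "n \<le> N" using n by auto
  obtain Z1 where Z1: "Z1 \<in> sets borel" "emeasure lborel Z1 \<le> ennreal (6 * L / q)"
    "\<And>i c. i \<in> S \<Longrightarrow> crowded t (P i) \<Longrightarrow> \<bar>c - P i \<bullet> dir t\<bar> \<le> w i \<Longrightarrow> c \<in> Z1" using crowded_small by metis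
  obtain Z2 where Z2: "Z2 \<in> sets borel" "emeasure lborel Z2 \<le> ennreal (12 * L / q)"
    "\<And>i c. i \<in> S \<Longrightarrow> heavy_tube t (P i) \<Longrightarrow> \<bar>c - P i \<bullet> dir t\<bar> \<le> w i \<Longrightarrow> c \<in> Z2" using heavy_tube_small by metis
  define V where "V = {i\<in>S. quiet (P i) l \<and> dense n (P i) l}"
  define I where "I i = {P i \<bullet> dir t - w i..P i \<bullet> dir t + w i}" for i
  define Q where "Q b U Z \<longleftrightarrow> U \<subseteq> S \<and> sum w U \<le> snd b / q \<and> Z \<in> sets borel \<and> emeasure lborel Z \<le> ennreal (4 * snd b / q) \<and>
    (\<forall>i z. i \<in> S - U \<longrightarrow> P i \<in> ball (fst b) (snd b) \<longrightarrow> \<not> dense n (P i) l \<longrightarrow> z \<in> E \<longrightarrow> dist z (P i) \<le> w i \<longrightarrow> z \<bullet> dir t \<in> Z)" for b U Z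
  have "\<exists>U Z. Q b U Z" if b: "b \<in> cov n" for b
    using lipschitz_piece[OF n t inn b] unfolding Q_def by metis
  then obtain U Z where "\<And>b. b \<in> cov n \<Longrightarrow> Q b (U b) (Z b)" by metis
  then have UZ: "U b \<subseteq> S" "sum w (U b) \<le> snd b / q" "Z b \<in> sets borel" "emeasure lborel (Z b) \<le> ennreal (4 * snd b / q)"
    "\<And>i z. i \<in> S - U b \<Longrightarrow> P i \<in> ball (fst b) (snd b) \<Longrightarrow> \<not> dense n (P i) l \<Longrightarrow> z \<in> E \<Longrightarrow> dist z (P i) \<le> w i \<Longrightarrow> z \<bullet> dir t \<in> Z b"
    if "b \<in> cov n" for b using that unfolding Q_def by blast+
  define J where "J V = (\<Union>i\<in>V. I i)" for V
  have Jm: "J V \<in> sets borel" if "V \<subseteq> S" for V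
    unfolding J_def I_def using that S_fin finite_subset by (intro sets.finite_UN) auto
  have Je: "emeasure lborel (J V) \<le> ennreal (2 * sum w V)" if "V \<subseteq> S" for V
    unfolding J_def I_def using that S_fin finite_subset w_nonneg by (intro emeasure_UN_Icc_le) auto
  have VS: "V \<subseteq> S" by (auto simp: V_def)
  have snd_pos: "0 \<le> snd b" if "b \<in> cov n" for b using cov_rad[OF n(1) nN that] rm_pos[OF n(1) nN] by simp
  let ?X = "\<Union>b\<in>cov n. J (U b) \<union> Z b"
  have Xm: "?X \<in> sets borel" using cov_fin[OF n(1) nN] UZ Jm by (intro sets.finite_UN sets.Un) auto
  have Xe: "emeasure lborel ?X \<le> ennreal (6 * L / q)"
  proof -
    have "emeasure lborel ?X \<le> (\<Sum>b\<in>cov n. emeasure lborel (J (U b) \<union> Z b))"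
      using cov_fin[OF n(1) nN] UZ Jm by (intro emeasure_subadditive_finite) auto
    also have "\<dots> \<le> (\<Sum>b\<in>cov n. ennreal (6 * snd b / q))"
    proof (intro sum_mono)
      fix b assume b: "b \<in> cov n"
      have "emeasure lborel (J (U b) \<union> Z b) \<le> emeasure lborel (J (U b)) + emeasure lborel (Z b)"
        using UZ[OF b] Jm by (intro emeasure_subadditive) auto
      also have "\<dots> \<le> ennreal (2 * (snd b / q)) + ennreal (4 * snd b / q)"
        using UZ[OF b] by (intro add_mono order_trans[OF Je[OF UZ(1)[OF b]]] ennreal_leI) auto
      also have "\<dots> = ennreal (6 * snd b / q)" using snd_pos[OF b] q by (subst ennreal_plus[symmetric]) (auto simp: field_simps)
      finally show "emeasure lborel (J (U b) \<union> Z b) \<le> ennreal (6 * snd b / q)" .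
    qed
    also have "\<dots> = ennreal (\<Sum>b\<in>cov n. 6 * snd b / q)" using snd_pos q by (intro sum_ennreal) auto
    also have "(\<Sum>b\<in>cov n. 6 * snd b / q) = 6 * sum snd (cov n) / q" by (simp add: sum_distrib_left sum_divide_distrib)
    also have "ennreal \<dots> \<le> ennreal (6 * L / q)" using cov_sum[OF n(1) nN] q by (intro ennreal_leI divide_right_mono) auto
    finally show ?thesis .
  qed
  have sub: "(\<lambda>z. z \<bullet> dir t) ` E \<subseteq> (Z1 \<union> Z2) \<union> (J V \<union> ?X)"
  proof
    fix c assume "c \<in> (\<lambda>z. z \<bullet> dir t) ` E"
    then obtain z where z: "z \<in> E" "c = z \<bullet> dir t" by auto
    obtain i where i: "i \<in> S" "dist z (P i) \<le> w i" using S_cover z by (auto simp: dist_commute)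
    have c: "\<bar>c - P i \<bullet> dir t\<bar> \<le> w i"
      using abs_inner_dir_le[of "z - P i" t] i z by (simp add: dist_norm inner_diff_left)
    then have cI: "c \<in> I i" by (auto simp: I_def)
    obtain b where b: "b \<in> cov n" "P i \<in> ball (fst b) (snd b)" using cov_cover[OF n(1) nN] P_in[OF i(1)] by blast
    show "c \<in> (Z1 \<union> Z2) \<union> (J V \<union> ?X)"
    proof (cases "crowded t (P i) \<or> heavy_tube t (P i) \<or> i \<in> V")
      case True then show ?thesis using Z1(3)[OF i(1) _ c] Z2(3)[OF i(1) _ c] cI by (auto simp: J_def)
    next
      case False
      then have "\<not> dense n (P i) l" using quietI[OF t] i by (auto simp: V_def)
      then have "c \<in> J (U b) \<union> Z b" using UZ(5)[OF b(1) _ b(2)] i z cI by (auto simp: J_def)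
      then show ?thesis using b by blast
    qed
  qed
  have "emeasure lborel ((\<lambda>z. z \<bullet> dir t) ` E) \<le> emeasure lborel ((Z1 \<union> Z2) \<union> (J V \<union> ?X))"
    using sub Z1 Z2 Jm[OF VS] Xm by (intro emeasure_mono) auto
  also have "\<dots> \<le> emeasure lborel (Z1 \<union> Z2) + emeasure lborel (J V \<union> ?X)"
    using Z1 Z2 Jm[OF VS] Xm by (intro emeasure_subadditive) auto
  also have "\<dots> \<le> (emeasure lborel Z1 + emeasure lborel Z2) + (emeasure lborel (J V) + emeasure lborel ?X)"
    using Z1 Z2 Jm[OF VS] Xm by (intro add_mono emeasure_subadditive) auto
  also have "\<dots> \<le> (ennreal (6 * L / q) + ennreal (12 * L / q)) + (ennreal (2 * sum w V) + ennreal (6 * L / q))"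
    using Z1 Z2 Je[OF VS] Xe by (intro add_mono) auto
  also have "\<dots> = ennreal (24 * L / q + 2 * sum w V)"
  proof -
    have "0 \<le> sum w V" using VS w_nonneg by (intro sum_nonneg) auto
    then show ?thesis using L q by (simp add: field_simps flip: ennreal_plus)
  qed
  finally show ?thesis by (simp add: V_def)
qed

lemma projection_le_trivial: "emeasure lborel ((\<lambda>z. z \<bullet> dir t) ` E) \<le> ennreal (4 * L)"
proof -
  have "(\<lambda>z. z \<bullet> dir t) ` E \<subseteq> (\<Union>i\<in>S. {P i \<bullet> dir t - w i..P i \<bullet> dir t + w i})"
  proof
    fix c assume "c \<in> (\<lambda>z. z \<bullet> dir t) ` E"
    then obtain z where z: "z \<in> E" "c = z \<bullet> dir t" by auto
    obtain i where i: "i \<in> S" "dist z (P i) \<le> w i" using S_cover z by (auto simp: dist_commute)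
    have "\<bar>c - P i \<bullet> dir t\<bar> \<le> w i"
      using abs_inner_dir_le[of "z - P i" t] i z by (simp add: dist_norm inner_diff_left)
    then show "c \<in> (\<Union>i\<in>S. {P i \<bullet> dir t - w i..P i \<bullet> dir t + w i})" using i by (intro UN_I[of i]) auto
  qed
  then have "emeasure lborel ((\<lambda>z. z \<bullet> dir t) ` E) \<le> emeasure lborel (\<Union>i\<in>S. {P i \<bullet> dir t - w i..P i \<bullet> dir t + w i})"
    using S_fin by (intro emeasure_mono) (auto intro!: sets.finite_UN)
  also have "\<dots> \<le> ennreal (2 * sum w S)" using S_fin w_nonneg by (intro emeasure_UN_Icc_le) auto
  also have "\<dots> \<le> ennreal (4 * L)" using w_sum by (intro ennreal_leI) auto
  finally show ?thesis .
qed

text \<open>With \<open>M\<close> scales in all, a quiet leaf is dense at fewer than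
  \<open>M / q\<close> of them unless it lies in the exceptional set \<open>?G\<close>.
  \<open>few_bad_many_dense_card\<close> makes \<open>?G\<close> a proportion at most
  \<open>1 / q\<close>, so it contributes the same amount again.\<close>

lemma average_dense:
  "(\<Sum>n\<in>{n0..N - g}. real (card {l\<in>{..<2 ^ \<Lambda>}. quiet x l \<and> dense n x l})) \<le> 2 ^ \<Lambda> * (2 * card {n0..N - g} / q)"
proof -
  define T where "T = {..<(2::nat) ^ \<Lambda>}"
  define M where "M = card {n0..N - g}"
  define \<tau> where "\<tau> = M / q"
  have M: "0 < M" using n0 by (simp add: M_def)
  have \<tau>: "0 < \<tau>" using M q by (simp add: \<tau>_def)
  let ?G = "{l\<in>T. card {n\<in>{n0..N - g}. bad n x l} \<le> \<eta> * \<tau> / 2 \<and> \<tau> \<le> card {n\<in>{n0..N - g}. dense n x l}}"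
  have "card ?G * (\<eta> * \<tau> - \<eta> * \<tau> / 2)\<^sup>2 \<le> card T * (2 * real g * card {n0..N - g})"
  proof (rule few_bad_many_dense_card[where c = "\<lambda>n l. l div 2 ^ (\<Lambda> - a n)"])
    fix m n i j :: nat assume mn: "m \<in> {n0..N - g}" "n \<in> {n0..N - g}" "m + g \<le> n" and eq: "i div 2 ^ (\<Lambda> - a n) = j div 2 ^ (\<Lambda> - a n)"
    have nN: "n0 \<le> n" "n \<le> N" using mn by auto
    have down: "i div 2 ^ (\<Lambda> - b) = j div 2 ^ (\<Lambda> - b)" if "b \<le> a n" for b
    proof -
      have "(2::nat) ^ (\<Lambda> - b) = 2 ^ (\<Lambda> - a n) * 2 ^ (a n - b)"
        using that a_bound[OF nN] by (simp flip: power_add)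
      then show ?thesis using eq by (simp add: div_mult2_eq)
    qed
    have amn: "a m \<le> a n" "a (m + g) \<le> a n" using a_mono[of m n] a_mono[of "m + g" n] mn by auto
    have "hit m (m + g) x i = hit m (m + g) x j" unfolding hit_def using down[OF amn(2)] by simp
    moreover have "heavy m x i = heavy m x j"
      unfolding heavy_def by (intro bex_cong refl) (use down amn in auto)
    ultimately show "i div 2 ^ (\<Lambda> - a m) = j div 2 ^ (\<Lambda> - a m) \<and> bad m x i = bad m x j"
      using down[OF amn(1)] by (simp add: bad_def)
  next
    fix n l assume nl: "n \<in> {n0..N - g}" "l \<in> T"
    have "n \<le> N" using nl by auto
    then have aL: "a n \<le> \<Lambda>" using a_bound[of n] nl by auto
    \<comment> \<open>Arcs do not cross the end of \<open>T\<close>, so counting leaves inside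
      \<open>T\<close> agrees with \<open>dense\<close>, which counts over all naturals.\<close>
    have inT: "l' \<in> T" if "l' div 2 ^ (\<Lambda> - a n) = l div 2 ^ (\<Lambda> - a n)" for l'
    proof -
      have 2: "(2::nat) ^ \<Lambda> = 2 ^ a n * 2 ^ (\<Lambda> - a n)" using aL by (simp flip: power_add)
      have "l div 2 ^ (\<Lambda> - a n) < 2 ^ a n" using nl(2) unfolding T_def 2 by (simp add: less_mult_imp_div_less)
      then have "l' < 2 ^ a n * 2 ^ (\<Lambda> - a n)" using that by (metis div_less_iff_less_mult zero_less_numeral zero_less_power)
      then show ?thesis by (simp add: T_def 2)
    qed
    then have "{j\<in>T. j div 2 ^ (\<Lambda> - a n) = l div 2 ^ (\<Lambda> - a n)} = {j. j div 2 ^ (\<Lambda> - a n) = l div 2 ^ (\<Lambda> - a n)}"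
      "{j\<in>T. j div 2 ^ (\<Lambda> - a n) = l div 2 ^ (\<Lambda> - a n) \<and> bad n x j} = {j. j div 2 ^ (\<Lambda> - a n) = l div 2 ^ (\<Lambda> - a n) \<and> bad n x j}"
      by auto
    then show "dense n x l \<longleftrightarrow> \<eta> * card {j\<in>T. j div 2 ^ (\<Lambda> - a n) = l div 2 ^ (\<Lambda> - a n)} <
       card {j\<in>T. j div 2 ^ (\<Lambda> - a n) = l div 2 ^ (\<Lambda> - a n) \<and> bad n x j}"
      by (simp add: dense_def card_div_eq(2))
  qed (use \<tau> \<eta>01 g in \<open>auto simp: T_def\<close>)
  then have 1: "card ?G * (\<eta> * \<tau>)\<^sup>2 \<le> 2 ^ \<Lambda> * (8 * real g * M)"
    by (simp add: T_def M_def power2_eq_square field_simps)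
  have "card ?G * M \<le> 2 ^ \<Lambda> * \<tau>"
  proof -
    \<comment> \<open>The exponent 11 in \<open>many\<close> is 8 from the square of
      \<open>\<eta>\<close>, 2 from the square of \<open>\<tau>\<close> and 1 for the wanted
      proportion \<open>1 / q\<close>.\<close>
    have "8 * real g * M \<le> (\<eta> * \<tau>)\<^sup>2 / q"
    proof -
      have m: "8 * g * q ^ 11 \<le> real M" using many(2) by (simp only: M_def)
      have "8 * real g * M = (8 * g * q ^ 11) * M / q ^ 11" using q by simp
      also have "\<dots> \<le> real M * M / q ^ 11" by (intro divide_right_mono mult_right_mono m) (use q in auto)
      also have "\<dots> = (\<eta> * \<tau>)\<^sup>2 / q" using q by (simp add: \<eta>_def \<tau>_def field_simps power_numeral_reduce)
      finally show ?thesis .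
    qed
    then have "2 ^ \<Lambda> * (8 * real g * M) \<le> 2 ^ \<Lambda> * ((\<eta> * \<tau>)\<^sup>2 / q)" by (intro mult_left_mono) auto
    with 1 have "card ?G * (\<eta> * \<tau>)\<^sup>2 \<le> (2 ^ \<Lambda> / q) * (\<eta> * \<tau>)\<^sup>2" by simp
    then have "card ?G \<le> 2 ^ \<Lambda> / q" using \<eta>01 \<tau> by (subst (asm) mult_le_cancel_right) auto
    then have "card ?G * real M \<le> 2 ^ \<Lambda> / q * M" by (intro mult_right_mono) auto
    then show ?thesis by (simp add: \<tau>_def)
  qed
  have "(\<Sum>n\<in>{n0..N - g}. real (card {l\<in>T. quiet x l \<and> dense n x l}))
      = (\<Sum>n\<in>{n0..N - g}. \<Sum>l\<in>T. of_bool (quiet x l \<and> dense n x l))"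
    by (intro sum.cong refl) (simp add: T_def Int_def)
  also have "\<dots> = (\<Sum>l\<in>T. \<Sum>n\<in>{n0..N - g}. of_bool (quiet x l \<and> dense n x l))" by (rule sum.swap)
  also have "\<dots> \<le> (\<Sum>l\<in>T. \<tau> + M * of_bool (l \<in> ?G))"
  proof (intro sum_mono)
    fix l assume l: "l \<in> T"
    have s: "(\<Sum>n\<in>{n0..N - g}. of_bool (quiet x l \<and> dense n x l) :: real) = of_bool (quiet x l) * card {n\<in>{n0..N - g}. dense n x l}"
      by (cases "quiet x l") (simp_all add: Int_def)
    have "card {n\<in>{n0..N - g}. dense n x l} \<le> M" unfolding M_def by (intro card_mono) auto
    moreover have "quiet x l \<longleftrightarrow> card {n\<in>{n0..N - g}. bad n x l} \<le> \<eta> * \<tau> / 2" by (simp add: quiet_def \<tau>_def M_def)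
    ultimately show "(\<Sum>n\<in>{n0..N - g}. of_bool (quiet x l \<and> dense n x l)) \<le> \<tau> + M * of_bool (l \<in> ?G)"
      unfolding s using l \<tau> by (cases "quiet x l"; cases "\<tau> \<le> card {n\<in>{n0..N - g}. dense n x l}") auto
  qed
  also have "\<dots> = 2 ^ \<Lambda> * \<tau> + M * card ?G"
  proof -
    have "(\<Sum>l\<in>T. of_bool (l \<in> Z) :: real) = card (T \<inter> Z)" for Z by (simp add: T_def)
    moreover have "T \<inter> ?G = ?G" by auto
    ultimately have "(\<Sum>l\<in>T. of_bool (l \<in> ?G) :: real) = card ?G" by metis
    then show ?thesis by (simp only: sum.distrib sum_distrib_left[symmetric]) (simp add: T_def)
  qed
  also have "\<dots> \<le> 2 ^ \<Lambda> * (2 * \<tau>)" using \<open>card ?G * M \<le> 2 ^ \<Lambda> * \<tau>\<close> by (simp add: mult.commute)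
  finally show ?thesis by (simp add: \<tau>_def M_def T_def)
qed

text \<open>Each arc loses two end pieces of proportion \<open>1 / 2 ^ \<beta>\<close>, at most
  \<open>1 / q\<close> each.\<close>

lemma card_not_central:
  assumes "n0 \<le> n" "n \<le> N"
  shows "card {l\<in>{..<2 ^ \<Lambda>}. \<not> central n l} \<le> 2 * 2 ^ \<Lambda> / q"
proof -
  define m where "m = (2::nat) ^ (\<Lambda> - a n)"
  define s where "s = (2::nat) ^ (\<Lambda> - a n - \<beta>)"
  have b: "a n + \<beta> \<le> \<Lambda>" using a_bound assms by auto
  have 2: "(2::nat) ^ \<Lambda> = 2 ^ a n * m" "m = 2 ^ \<beta> * s" using b by (auto simp: m_def s_def simp flip: power_add)
  have "{l\<in>{..<2 ^ \<Lambda>}. \<not> central n l} \<subseteq> {l. l < 2 ^ a n * m \<and> l mod m \<in> {..<s} \<union> {m - s..<m}}"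
    unfolding central_def m_def[symmetric] s_def[symmetric] 2(1) by (auto simp: m_def)
  then have "card {l\<in>{..<2 ^ \<Lambda>}. \<not> central n l} \<le> card {l. l < 2 ^ a n * m \<and> l mod m \<in> {..<s} \<union> {m - s..<m}}"
    by (intro card_mono) auto
  also have "\<dots> \<le> 2 ^ a n * card ({..<s} \<union> {m - s..<m})"
    by (rule card_mod_le) (use 2 in auto)
  also have "\<dots> \<le> 2 ^ a n * (2 * s)"
    using card_Un_le[of "{..<s}" "{m - s..<m}"] by (intro mult_left_mono) auto
  finally have "real (card {l\<in>{..<2 ^ \<Lambda>}. \<not> central n l}) \<le> real (2 ^ a n * (2 * s))" by (simp only: of_nat_le_iff)
  also have "\<dots> \<le> 2 * 2 ^ \<Lambda> / q"
  proof -
    have "(2::real) ^ \<Lambda> = 2 ^ a n * (2 ^ \<beta> * s)" using 2 by (metis of_nat_mult of_nat_numeral of_nat_power)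
    moreover have "q * (2 ^ a n * real s) \<le> 2 ^ \<beta> * (2 ^ a n * real s)" using \<beta> by (intro mult_right_mono) auto
    ultimately show ?thesis using q by (simp add: field_simps)
  qed
  finally show ?thesis .
qed

text \<open>Averaging \<open>average_dense\<close> over the points gives one scale \<open>n\<close>
  with little weight in dense arcs. Then 40 is 24 from \<open>projection_le\<close>, 8 from this
  weight and 8 from the leaves that are not central, where only \<open>projection_le_trivial\<close>
  is available.\<close>

lemma favard_bound: "favard E \<le> ennreal (40 * L / q)"
proof -
  define T where "T = {..<(2::nat) ^ \<Lambda>}"
  define A where "A n = (\<Sum>i\<in>S. w i * card {l\<in>T. quiet (P i) l \<and> dense n (P i) l})" for n
  have "\<exists>n\<in>{n0..N - g}. A n \<le> 2 ^ \<Lambda> * (4 * L / q)"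
  proof (rule ccontr)
    assume "\<not> ?thesis"
    then have "(\<Sum>n\<in>{n0..N - g}. 2 ^ \<Lambda> * (4 * L / q)) < (\<Sum>n\<in>{n0..N - g}. A n)"
      using n0 by (intro sum_strict_mono) (auto simp: not_le)
    also have "\<dots> = (\<Sum>i\<in>S. w i * (\<Sum>n\<in>{n0..N - g}. real (card {l\<in>T. quiet (P i) l \<and> dense n (P i) l})))"
      unfolding A_def by (subst sum.swap) (simp add: sum_distrib_left)
    also have "\<dots> \<le> (\<Sum>i\<in>S. w i * (2 ^ \<Lambda> * (2 * card {n0..N - g} / q)))"
      using average_dense w_nonneg unfolding T_def by (intro sum_mono mult_left_mono) auto
    also have "\<dots> = sum w S * (2 ^ \<Lambda> * (2 * card {n0..N - g} / q))" by (simp only: sum_distrib_right)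
    also have "\<dots> \<le> 2 * L * (2 ^ \<Lambda> * (2 * card {n0..N - g} / q))" using w_sum q by (intro mult_right_mono) auto
    finally show False by (simp add: mult_ac)
  qed
  then obtain n where n: "n0 \<le> n" "n + g \<le> N" and A: "A n \<le> 2 ^ \<Lambda> * (4 * L / q)" using n0 by auto
  define D where "D l = sum w {i\<in>S. quiet (P i) l \<and> dense n (P i) l}" for l
  have D0: "0 \<le> D l" for l unfolding D_def using w_nonneg by (intro sum_nonneg) auto
  define B where "B l = 24 * L / q + 2 * D l + 4 * L * of_bool (\<not> central n l)" for l
  have "favard E \<le> ennreal ((\<Sum>l<2 ^ \<Lambda>. B l) / 2 ^ \<Lambda>)"
  proof (rule favard_le[OF compact_E])
    show "0 \<le> B l" for l using D0[of l] L q by (simp add: B_def)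
    fix l t assume t: "t \<in> cell \<Lambda> l"
    show "emeasure lborel ((\<lambda>z. z \<bullet> dir t) ` E) \<le> ennreal (B l)"
    proof (cases "central n l")
      case True then show ?thesis using projection_le[OF n t] by (simp add: B_def D_def)
    next
      case False
      have "4 * L \<le> B l" using False D0[of l] L q by (simp add: B_def)
      then show ?thesis using projection_le_trivial[of t] by (meson ennreal_leI order_trans)
    qed
  qed
  also have "(\<Sum>l<2 ^ \<Lambda>. B l) \<le> 2 ^ \<Lambda> * (40 * L / q)"
  proof -
    have "(\<Sum>l\<in>T. D l) = (\<Sum>l\<in>T. \<Sum>i\<in>S. w i * of_bool (quiet (P i) l \<and> dense n (P i) l))"
      unfolding D_def sum.inter_filter[OF S_fin] by (intro sum.cong refl) auto
    also have "\<dots> = (\<Sum>i\<in>S. \<Sum>l\<in>T. w i * of_bool (quiet (P i) l \<and> dense n (P i) l))" by (rule sum.swap)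
    also have "\<dots> = A n" unfolding A_def
      by (intro sum.cong refl) (simp add: T_def Int_def flip: sum_distrib_left)
    finally have sD: "(\<Sum>l\<in>T. D l) \<le> 2 ^ \<Lambda> * (4 * L / q)" using A by simp
    have "(\<Sum>l\<in>T. of_bool (\<not> central n l) :: real) = card {l\<in>T. \<not> central n l}" by (simp add: T_def Int_def)
    then have sI: "(\<Sum>l\<in>T. of_bool (\<not> central n l) :: real) \<le> 2 * 2 ^ \<Lambda> / q"
      using card_not_central[of n] n unfolding T_def by simp
    have "(\<Sum>l\<in>T. B l) = 2 ^ \<Lambda> * (24 * L / q) + 2 * (\<Sum>l\<in>T. D l) + 4 * L * (\<Sum>l\<in>T. of_bool (\<not> central n l))"
      unfolding B_def sum.distrib sum_distrib_left[symmetric] by (simp add: T_def)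
    also have "\<dots> \<le> 2 ^ \<Lambda> * (24 * L / q) + 2 * (2 ^ \<Lambda> * (4 * L / q)) + 4 * L * (2 * 2 ^ \<Lambda> / q)"
      using sD sI L by (intro add_mono mult_left_mono) auto
    also have "\<dots> = 2 ^ \<Lambda> * (40 * L / q)" by (simp add: field_simps)
    finally show ?thesis by (simp add: T_def)
  qed
  then have "ennreal ((\<Sum>l<2 ^ \<Lambda>. B l) / 2 ^ \<Lambda>) \<le> ennreal (40 * L / q)"
    by (intro ennreal_leI) (simp add: field_simps)
  finally show ?thesis .
qed

end

section \<open>Choice of the parameters and conclusion\<close>

lemma floor_log2_bounds:
  assumes "1 \<le> y"
  shows "2 ^ nat \<lfloor>log 2 y\<rfloor> \<le> y" "y \<le> 2 * 2 ^ nat \<lfloor>log 2 y\<rfloor>"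
proof -
  define k where "k = nat \<lfloor>log 2 y\<rfloor>"
  have k: "real k \<le> log 2 y" "log 2 y < real k + 1" using assms by (auto simp: k_def)
  have "2 powr real k \<le> y" using k(1) assms by (simp add: le_log_iff)
  then show "2 ^ nat \<lfloor>log 2 y\<rfloor> \<le> y" by (simp add: k_def powr_realpow)
  have "y < 2 powr (real k + 1)" using k(2) assms by (simp add: log_less_iff)
  then show "y \<le> 2 * 2 ^ nat \<lfloor>log 2 y\<rfloor>" by (simp add: k_def powr_add powr_realpow)
qed

lemma favard_le_many_scales:
  fixes L :: real and E :: "pt set" and N :: nat and rm rp :: "nat \<Rightarrow> real"
  assumes L: "0 < L" and E: "compact E" and sph: "sph_measure E \<le> ennreal L"
    and rmN: "0 < rm N" and rmrp: "\<And>n. 1 \<le> n \<Longrightarrow> n \<le> N \<Longrightarrow> rm n \<le> rp n" and rp1: "rp 1 \<le> 1"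
    and content: "\<And>n. 1 \<le> n \<Longrightarrow> n \<le> N \<Longrightarrow> sph_content (rm n) (rp n) E \<le> ennreal L"
    and half: "\<And>n. 1 \<le> n \<Longrightarrow> n < N \<Longrightarrow> rp (Suc n) \<le> rm n / 2"
    and rect: "\<And>n. 1 \<le> n \<Longrightarrow> n < N \<Longrightarrow> rect_const E (rp (Suc n)) (rm n) (1 / rm n) \<le> 1 / q"
    and q: "4000 \<le> q" and Nq: "q ^ 20 \<le> N"
  shows "favard E \<le> ennreal (40 * L / q)"
proof -
  \<comment> \<open>After a third of the scales, \<open>rp n \<le> 1 / 2 ^ (n - 1)\<close> is tiny
    against \<open>1 / q\<close>. As \<open>g\<close> is at most \<open>N / 3\<close>, at least a
    third of the scales remain.\<close>
  define n0 where "n0 = N div 3"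
  define g where "g = nat \<lceil>q ^ 7\<rceil>"
  define \<eta> where "\<eta> = 1 / q ^ 4"
  define a where "a n = nat \<lfloor>log 2 (1 / (2 * q * rm n))\<rfloor>" for n
  \<comment> \<open>\<open>Suc\<close> rounds the logarithm up, giving
    \<open>q \<le> 2 ^ \<beta>\<close>; the cost is the factor 2 in
    \<open>2 ^ \<beta> \<le> 2 * q\<close>.\<close>
  define \<beta> where "\<beta> = Suc (nat \<lfloor>log 2 q\<rfloor>)"
  define \<Lambda> where "\<Lambda> = a N + \<beta>"
  define rs where "rs = (rm N)\<^sup>2 / 4"
  have pow: "4000 * q ^ k \<le> q ^ Suc k" for k using q by (simp add: mult_right_mono)
  have pow1: "1 \<le> q ^ k" for k using q by (intro one_le_power) auto
  have g1: "q ^ 7 \<le> g" "g \<le> q ^ 7 + 1" unfolding g_def using q by (auto simp: le_of_int_ceiling)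
  have p67: "4000 * q ^ 6 \<le> q ^ 7" using pow[of 6] by simp
  have p18: "4000 * q ^ 18 \<le> q ^ 20" using pow[of 18] pow[of 19] pow1[of 18] by (simp add: eval_nat_numeral)
  have p718: "q ^ 7 \<le> q ^ 18" "q \<le> q ^ 18" using q power_increasing[of 7 18 q] power_increasing[of 1 18 q] by auto
  have q18: "4000 \<le> q ^ 18" using p718 q by simp
  have N_big: "4000 * q ^ 18 \<le> N" using p18 Nq by simp
  have gN: "3 * real g \<le> N" using g1 p718 N_big q18 by linarith
  have n0N: "3 * n0 \<le> N" "N \<le> 3 * n0 + 2" by (auto simp: n0_def)
  have n0N': "3 * real n0 \<le> N" "real N \<le> 3 * real n0 + 2" using n0N by linarith+
  have g5: "5 \<le> g" using g1 p67 pow1[of 6] by linarith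
  have n0g: "n0 + g \<le> N" using gN n0N by linarith
  have n01: "1 \<le> n0" using n0N' N_big q18 by linarith
  have card: "real N / 3 \<le> card {n0..N - g}"
  proof -
    have "card {n0..N - g} = Suc (N - g) - n0" by simp
    then have "real (card {n0..N - g}) = real N - real g + 1 - real n0" using n0g by linarith
    then show ?thesis using gN n0N' by linarith
  qed
  \<comment> \<open>Positivity is given at \<open>N\<close> only and spreads to larger scales by
    downward induction.\<close>
  have rm_pos: "0 < rm n" if "1 \<le> n" "n \<le> N" for n
    using that(2,1)
  proof (induction n rule: inc_induct)
    case base then show ?case using rmN by simp
  next
    case (step n)
    have "0 < rm (Suc n)" using step by simp
    also have "\<dots> \<le> rp (Suc n)" using rmrp step by simp
    also have "\<dots> \<le> rm n / 2" using half step by simp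
    finally show ?case by simp
  qed
  have rp_pow: "rp n * 2 ^ (n - 1) \<le> 1" if "1 \<le> n" "n \<le> N" for n
    using that
  proof (induction n rule: dec_induct)
    case base then show ?case using rp1 by simp
  next
    case (step n)
    have "rp (Suc n) \<le> rp n / 2" using half[of n] rmrp[of n] step by simp
    then have "rp (Suc n) * 2 ^ n \<le> rp n / 2 * 2 ^ n" by (intro mult_right_mono) auto
    also have "\<dots> = rp n * 2 ^ (n - 1)" using step by (cases n) auto
    finally show ?case using step by simp
  qed
  have rp_small: "120 * q * rp n \<le> 1" if n: "n0 \<le> n" "n \<le> N" for n
  proof -
    have n1: "1 \<le> n" using n n01 by simp
    have rp0: "0 \<le> rp n" using rm_pos[OF n1 n(2)] rmrp[OF n1 n(2)] by simp
    have "120 * q \<le> real n" using n n0N' N_big p718 q18 by linarith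
    also have "\<dots> \<le> real (2 ^ (n - 1))"
    proof -
      have "n - 1 < 2 ^ (n - 1)" by (rule less_exp)
      then have "n \<le> 2 ^ (n - 1)" using n1 by linarith
      then show ?thesis by (simp only: of_nat_le_iff)
    qed
    finally have "120 * q * rp n \<le> 2 ^ (n - 1) * rp n" using rp0 by (intro mult_right_mono) auto
    then show ?thesis using rp_pow[OF n1 n(2)] by (simp add: mult.commute)
  qed
  have y1: "1 \<le> 1 / (2 * q * rm n)" "0 < rm n" if n: "n0 \<le> n" "n \<le> N" for n
  proof -
    show rm: "0 < rm n" using rm_pos[of n] n n01 by simp
    have "2 * q * rm n \<le> 120 * q * rp n" using rmrp[of n] n n01 q rm by (intro mult_mono) auto
    then have "2 * q * rm n \<le> 1" using rp_small[OF n] by simp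
    then show "1 \<le> 1 / (2 * q * rm n)" using rm q by simp
  qed
  have a1: "2 * q * rm n \<le> 1 / 2 ^ a n" "1 / 2 ^ a n \<le> 4 * q * rm n" if n: "n0 \<le> n" "n \<le> N" for n
    using floor_log2_bounds[OF y1(1)[OF n]] y1(2)[OF n] q unfolding a_def[symmetric] by (auto simp: field_simps)
  have rm_anti: "rm n \<le> rm m" if "m \<le> n" "1 \<le> m" "n \<le> N" for m n
    using that
  proof (induction n rule: dec_induct)
    case (step n)
    have "rm (Suc n) \<le> rm n" using rmrp[of "Suc n"] half[of n] rm_pos[of n] step by auto
    then show ?case using step by simp
  qed simp
  have a_mono: "a m \<le> a n" if mn: "n0 \<le> m" "m \<le> n" "n \<le> N" for m n
  proof -
    have "rm n \<le> rm m" using rm_anti[of m n] mn n01 by simp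
    moreover have rm: "0 < q * rm m" using y1(2)[of m] mn q by simp
    ultimately have "1 / (2 * q * rm m) \<le> 1 / (2 * q * rm n)"
      using y1(2)[of m] y1(2)[of n] mn q by (intro divide_left_mono mult_left_mono) auto
    then show ?thesis unfolding a_def using rm by (intro nat_mono floor_mono log_mono) auto
  qed
  define Q where "Q n B \<longleftrightarrow> finite B \<and> (\<forall>b\<in>B. rm n \<le> snd b \<and> snd b \<le> rp n) \<and>
      E \<subseteq> (\<Union>b\<in>B. ball (fst b) (snd b)) \<and> sum snd B \<le> L" for n and B :: "(pt \<times> real) set"
  have "\<exists>B. Q n B" if n: "1 \<le> n" "n \<le> N" for n
  proof -
    obtain B where "finite B" "\<And>b. b \<in> B \<Longrightarrow> rm n \<le> snd b \<and> snd b \<le> rp n"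
      "E \<subseteq> (\<Union>b\<in>B. ball (fst b) (snd b))" "sum snd B \<le> L"
      by (rule finite_cover_of_content[OF E L content[OF n] less_imp_le[OF rm_pos[OF n]]]) blast
    then have "Q n B" by (simp add: Q_def)
    then show ?thesis ..
  qed
  then obtain cov where "\<And>n. 1 \<le> n \<Longrightarrow> n \<le> N \<Longrightarrow> Q n (cov n)" by metis
  then have cov: "finite (cov n)" "\<And>b. b \<in> cov n \<Longrightarrow> rm n \<le> snd b \<and> snd b \<le> rp n"
      "E \<subseteq> (\<Union>b\<in>cov n. ball (fst b) (snd b))" "sum snd (cov n) \<le> L" if "n0 \<le> n" "n \<le> N" for n
    using that n01 unfolding Q_def by auto
  have rs: "0 < rs" using rmN by (simp add: rs_def)
  \<comment> \<open>Recentring a ball at a point of \<open>E\<close> inside it doubles the radius: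
    hence radii up to \<open>rs / 2\<close>, weights \<open>2 * snd b\<close> and total weight
    \<open>2 * L\<close>.\<close>
  have "sph_content 0 (rs / 2) E \<le> ennreal L"
    using sph_content_le_measure[of "rs / 2" E] sph rs by (auto intro: order_trans)
  then obtain S :: "(pt \<times> real) set" where S: "finite S" "\<And>b. b \<in> S \<Longrightarrow> 0 \<le> snd b \<and> snd b \<le> rs / 2" "E \<subseteq> (\<Union>b\<in>S. ball (fst b) (snd b))"
    "sum snd S \<le> L" "\<And>b. b \<in> S \<Longrightarrow> \<exists>x\<in>E. x \<in> ball (fst b) (snd b)"
    by (rule finite_cover_of_content[OF E L _ order_refl]) blast
  have "\<forall>b\<in>S. \<exists>x. x \<in> E \<and> x \<in> ball (fst b) (snd b)" using S(5) by blast
  then obtain P where P: "\<forall>b\<in>S. P b \<in> E \<and> P b \<in> ball (fst b) (snd b)" by (rule bchoice[THEN exE])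
  have "multiscale E L q \<eta> rs n0 N g \<Lambda> \<beta> rm rp a cov S P (\<lambda>b. 2 * snd b)"
  proof
    show "E \<subseteq> (\<Union>i\<in>S. cball (P i) (2 * snd i))"
    proof
      fix x assume "x \<in> E"
      then obtain b where b: "b \<in> S" "x \<in> ball (fst b) (snd b)" using S(3) by blast
      have "dist (P b) x \<le> dist (P b) (fst b) + dist (fst b) x" by (rule dist_triangle)
      then have "x \<in> cball (P b) (2 * snd b)" using b bspec[OF P b(1)] by (auto simp: dist_commute)
      then show "x \<in> (\<Union>i\<in>S. cball (P i) (2 * snd i))" using b by blast
    qed
    show "2 * snd b \<le> rs" if "b \<in> S" for b using S(2)[OF that] by simp
    show "q \<le> 2 ^ \<beta>" "2 ^ \<beta> \<le> 2 * q" using floor_log2_bounds[of q] q by (auto simp: \<beta>_def)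
    show "10 * N * q ^ 6 \<le> card {n0..N - g} * (real g - 4)"
    proof -
      have "30 * q ^ 6 \<le> real g - 4" using g1 p67 pow1[of 6] by linarith
      then have "N / 3 * (30 * q ^ 6) \<le> card {n0..N - g} * (real g - 4)" using card q by (intro mult_mono) auto
      then show ?thesis by simp
    qed
    show "8 * g * q ^ 11 \<le> card {n0..N - g}"
    proof -
      have "real g \<le> 2 * q ^ 7" using g1 pow1[of 7] by linarith
      then have "8 * g * q ^ 11 \<le> 8 * (2 * q ^ 7) * q ^ 11" using q by (intro mult_right_mono mult_left_mono) auto
      also have "\<dots> = 16 * q ^ 18" by (simp flip: power_add)
      also have "\<dots> \<le> N / 3" using N_big pow1[of 18] by linarith
      finally show ?thesis using card by linarith
    qed
  qed (use E L q rm_pos rmrp n01 rp_small half rect cov S P rs a1 a_mono n0g g5 in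
      \<open>auto simp: \<eta>_def rs_def \<Lambda>_def simp flip: sum_distrib_left\<close>)
  then show ?thesis by (rule multiscale.favard_bound)
qed

theorem theorem1p11:
  shows "\<exists>C>0. \<forall>(L::real) (E::pt set) (N::nat) (rm::nat \<Rightarrow> real) (rp::nat \<Rightarrow> real).
    L > 0 \<and> compact E \<and> E \<subseteq> ball 0 1 \<and> sph_measure E \<le> ennreal L \<and> N \<ge> 1 \<and>
    0 < rm N \<and> (\<forall>n\<in>{1..N}. rm n \<le> rp n) \<and> (\<forall>n\<in>{1..<N}. rp (n+1) \<le> rm n) \<and> rp 1 \<le> 1 \<and>
    (\<forall>n\<in>{1..N}. sph_content (rm n) (rp n) E \<le> ennreal L) \<and>
    (\<forall>n\<in>{1..<N}. rp (n+1) \<le> rm n / 2) \<and>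
    (\<forall>n\<in>{1..<N}. rect_const E (rp (n+1)) (rm n) (1 / rm n) \<le> real N powr (-1/100))
    \<longrightarrow> favard E \<le> ennreal (C * real N powr (-1/100) * L)"
proof (intro exI[of _ "8000::real"] conjI allI impI)
  fix L :: real and E :: "pt set" and N :: nat and rm rp :: "nat \<Rightarrow> real"
  assume H: "L > 0 \<and> compact E \<and> E \<subseteq> ball 0 1 \<and> sph_measure E \<le> ennreal L \<and> N \<ge> 1 \<and>
    0 < rm N \<and> (\<forall>n\<in>{1..N}. rm n \<le> rp n) \<and> (\<forall>n\<in>{1..<N}. rp (n+1) \<le> rm n) \<and> rp 1 \<le> 1 \<and>
    (\<forall>n\<in>{1..N}. sph_content (rm n) (rp n) E \<le> ennreal L) \<and>
    (\<forall>n\<in>{1..<N}. rp (n+1) \<le> rm n / 2) \<and>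
    (\<forall>n\<in>{1..<N}. rect_const E (rp (n+1)) (rm n) (1 / rm n) \<le> real N powr (-1/100))"
  define q where "q = real N powr (1/100)"
  have N: "1 \<le> real N" using H by simp
  have q1: "1 \<le> q" unfolding q_def using N by (intro ge_one_powr_ge_zero) auto
  have inv: "real N powr (-1/100) = 1 / q" unfolding q_def using powr_minus_divide[of "real N" "1/100"] by simp
  have "favard E \<le> ennreal (8000 * L / q)"
  proof (cases "4000 \<le> q")
    case True
    have "q ^ 100 = real N" unfolding q_def using N by (simp add: powr_powr flip: powr_realpow)
    moreover have "q ^ 20 \<le> q ^ 100" using q1 by (intro power_increasing) auto
    ultimately have Nq: "q ^ 20 \<le> N" by simp
    have "favard E \<le> ennreal (40 * L / q)"
      using H inv by (intro favard_le_many_scales[of L E rm N rp q] True Nq) auto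
    also have "\<dots> \<le> ennreal (8000 * L / q)" using H q1 by (intro ennreal_leI divide_right_mono) auto
    finally show ?thesis .
  next
    \<comment> \<open>For \<open>q < 4000\<close> the crude bound \<open>2 * L\<close> is below
      \<open>8000 * L / q\<close>; this case fixes the constant 8000.\<close>
    case False
    have "favard E \<le> ennreal (2 * L)" using H by (intro favard_le_content[of E L "rm N" "rp N"]) auto
    also have "2 * L \<le> 8000 * L / q"
    proof -
      have "2 * L * q \<le> 2 * L * 4000" using H False by (intro mult_left_mono) auto
      then show ?thesis using q1 by (simp add: field_simps)
    qed
    then have "ennreal (2 * L) \<le> ennreal (8000 * L / q)" by (rule ennreal_leI)
    finally show ?thesis .
  qed
  then show "favard E \<le> ennreal (8000 * real N powr (-1/100) * L)" unfolding inv by simp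
qed simp

end
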